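(* Let $\Omega\subset\mathbb{R}^N$ be a bounded $C^1$-domain, let $\mathcal{I}(u,x)=\int_{\mathbb{R}^N}[u(x+z)-u(x)]\,\nu_x(dz)$ satisfy assumptions (M0), (M1), (M2), (M3) of the context with the same $\sigma\in(0,1)$ and the iterative covering property of the context, let $H_0\in C(\bar\Omega\times\mathbb{R}^N)$ satisfy (H2) of the context with $m>1$, and let $c\in\mathbb{R}$ be the unique ergodic constant, i.e. the unique constant for which the state-constraint problem $$-\mathcal{I}(u)+H_0(x,Du)=c\ \text{in }\Omega,\qquad-\mathcal{I}(u)+H_0(x,Du)\ge c\ \text{on }\partial\Omega$$ has a viscosity solution in $C(\bar\Omega)$ that is Lipschitz continuous on $\bar\Omega$. Then the solution to this problem is unique up to an additive constant.
   Context: Notation: $d(x)=\mathrm{dist}(x,\partial\Omega)$, $B_r(x)$ is the open ball, $B_r=B_r(0)$, $B_r^c$ its complement. "$C^1$-domain" means that the boundary is $C^1$, with the convention that there is $\delta_0>0$ such that $d$ is of class $C^1$ in $\{x\in\Omega:d(x)<\delta_0\}$. For each $x\in\bar\Omega$, $\nu_x$ is a nonnegative regular measure on $\mathbb{R}^N$. For $D\subset\mathbb{R}^N$, $\mathcal{I}[D](u,y)=\int_D[u(y+z)-u(y)]\nu_y(dz)$. (M0): (M0-1) $\bigcup_{x\in\bar\Omega}\{x+\mathrm{supp}\,\nu_x\}\subseteq\bar\Omega$. (M0-2) if $x\in\bar\Omega$, $r>0$ and $u\in L^\infty(\bar\Omega)$ is $C^1$ in $B_r(x)$ (i.e. in $B_r(x)\cap\bar\Omega$),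 then $\mathcal{I}(u,x)$ is well defined, and for any $D\subset\mathbb{R}^N$ the map $y\mapsto\mathcal{I}[D](u,y)$ is continuous in $B_r(x)$ (i.e. in $B_r(x)\cap\bar\Omega$). (M1): there is $C_1>0$ such that for all $\beta\in[0,2]$ and $\delta>0$, $\sup_{x\in\bar\Omega}\int_{B_\delta^c}\min\{1,|z|^\beta\}\nu_x(dz)\le C_1h_{\beta,\sigma}(\delta)$, where $h_{\beta,\sigma}(\delta)=\delta^{\beta-\sigma}$ if $\beta<\sigma$, $=|\ln\delta|+1$ if $\beta=\sigma$, $=1$ if $\beta>\sigma$ (convention $|z|^0=1$). (M2): there is $C_2>0$ such that for all $\beta\in(\sigma,2]$ and $\delta\in(0,1)$, $\sup_{x\in\bar\Omega}\int_{B_\delta}|z|^\beta\nu_x(dz)\le C_2\delta^{\beta-\sigma}$. (M3): for each $\beta>0$ there is a modulus of continuity $\omega_{\beta,\sigma}$ such that for all $x,y\in\bar\Omega$, $\delta>0$, $\int_{B_\delta^c}|z|^\beta|\nu_x(dz)-\nu_y(dz)|\le(1+h_{\beta,\sigma}(\delta))\,\omega_{\beta,\sigma}(|x-y|)$, where $|\nu_x-\nu_y|$ is the total variation measure. Iterative covering property: with $X_0(x)=\{x\}$, $X_{n+1}(x)=\bigcup_{\xi\in X_n(x)}\{\xi+\mathrm{supp}\,\nu_\xi\}$ and $\mathcal{X}(x)=\overline{\bigcup_{n\in\mathbb{N}}X_n(x)}$, one has $\mathcal{X}(x)=\bar\Omega$ for all $x\in\bar\Omega$. (H2) for $H_0$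 (with exponent $m$): there are $\underline c>0$, $C\ge0$ with $H_0(x,p)\ge\underline c|p|^m-C$ for all $x\in\bar\Omega$, $p\in\mathbb{R}^N$. Viscosity solution of the state-constraint problem: a function $u\in C(\bar\Omega)$ which is a viscosity subsolution of the equation in $\Omega$ and a viscosity supersolution on $\bar\Omega$; that is, for $\phi\in C^1(\bar\Omega)$ and all $\delta>0$, $-\mathcal{I}[B_\delta](\phi,x_0)-\mathcal{I}[B_\delta^c](u,x_0)+H_0(x_0,D\phi(x_0))\le c$ at each maximum point $x_0\in\Omega$ of $u-\phi$ on $\bar\Omega$, and $\ge c$ at each minimum point $x_0\in\bar\Omega$ of $u-\phi$ on $\bar\Omega$. *)

theory Defs
  imports "HOL-Analysis.Analysis"
begin

subsection \<open>Functions of class C1, moduli of continuity, C1 domains\<close>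

text \<open>\<open>S\<close> is either open or a relatively open subset of the closure of a C1 domain. In both
  cases the gradient \<open>Df\<close> is uniquely determined by \<open>f\<close> on \<open>S\<close>, and at boundary points the
  condition says that \<open>f\<close> is C1 up to the boundary.\<close>

definition C1_on :: "'a::euclidean_space set \<Rightarrow> ('a \<Rightarrow> real) \<Rightarrow> ('a \<Rightarrow> 'a) \<Rightarrow> bool" where
  "C1_on S f Df \<longleftrightarrow>
     (\<forall>x\<in>S. (f has_derivative (\<lambda>h. Df x \<bullet> h)) (at x within S)) \<and> continuous_on S Df"

definition modulus_of_continuity :: "(real \<Rightarrow> real) \<Rightarrow> bool" where
  "modulus_of_continuity \<omega> \<longleftrightarrow>
     \<omega> 0 = 0 \<and> mono_on {0..} \<omega> \<and> (\<omega> \<longlongrightarrow> 0) (at_right 0)"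

text \<open>Near each boundary point, \<open>\<Omega>\<close> is the part above the graph of a C1 function \<open>g\<close> over the
  hyperplane orthogonal to a unit vector \<open>e\<close>; only the values of \<open>g\<close> on this hyperplane matter.\<close>

definition C1_boundary :: "'a::euclidean_space set \<Rightarrow> bool" where
  "C1_boundary \<Omega> \<longleftrightarrow>
     (\<forall>x\<in>frontier \<Omega>. \<exists>r>0. \<exists>e g Dg. norm e = 1 \<and> C1_on UNIV g Dg \<and>
        \<Omega> \<inter> ball x r = {y \<in> ball x r. g (y - (y \<bullet> e) *\<^sub>R e) < y \<bullet> e})"

definition bounded_C1_domain :: "'a::euclidean_space set \<Rightarrow> bool" where
  "bounded_C1_domain \<Omega> \<longleftrightarrow>
     open \<Omega> \<and> connected \<Omega> \<and> \<Omega> \<noteq> {} \<and> bounded \<Omega> \<and> C1_boundary \<Omega> \<and>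
     (\<exists>\<delta>\<^sub>0>0. \<exists>Dd. C1_on {x \<in> \<Omega>. infdist x (frontier \<Omega>) < \<delta>\<^sub>0}
                          (\<lambda>x. infdist x (frontier \<Omega>)) Dd)"


subsection \<open>Measures\<close>

definition measure_support :: "'a::topological_space measure \<Rightarrow> 'a set" where
  "measure_support M = {z. \<forall>U. open U \<longrightarrow> z \<in> U \<longrightarrow> emeasure M U \<noteq> 0}"

text \<open>The measures of interest may have infinite mass around the origin (for instance
  \<open>|z| powr (- N - \<sigma>) dz\<close>), so outer regularity can only be asked of sets not containing 0.\<close>

definition regular_borel_measure :: "'a::euclidean_space measure \<Rightarrow> bool" where
  "regular_borel_measure M \<longleftrightarrow>
     sets M = sets borel \<and>
     (\<forall>A\<in>sets borel. emeasure M A = (SUP K\<in>{K. compact K \<and> K \<subseteq> A}. emeasure M K)) \<and>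
     (\<forall>A\<in>sets borel. 0 \<notin> A \<longrightarrow> emeasure M A = (INF U\<in>{U. open U \<and> A \<subseteq> U}. emeasure M U))"

text \<open>The total variation measure \<open>|M - N|\<close> of the difference of two finite measures on the same
  measurable space: the supremum over finite measurable partitions.\<close>

definition total_variation_diff :: "'a measure \<Rightarrow> 'a measure \<Rightarrow> 'a measure" where
  "total_variation_diff M N = measure_of (space M) (sets M)
     (\<lambda>A. SUP P\<in>{P. finite P \<and> P \<subseteq> sets M \<and> disjoint P \<and> \<Union>P = A}.
            \<Sum>B\<in>P. ennreal \<bar>measure M B - measure N B\<bar>)"


subsection \<open>The nonlocal operator and the assumptions on its measures\<close>

text \<open>\<open>I[D](u,y)\<close>. Functions on the closure of \<open>\<Omega>\<close> are represented by total functions whose values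
  elsewhere are irrelevant, hence the restriction to \<open>y + z \<in> closure \<Omega>\<close>; by (M0-1) the removed
  set is null for \<open>\<nu> y\<close>.\<close>

definition nonlocal_set :: "'a::euclidean_space set \<Rightarrow> 'a set \<Rightarrow> 'a \<Rightarrow> 'a set" where
  "nonlocal_set \<Omega> D y = {z \<in> D. y + z \<in> closure \<Omega>}"

definition nonlocal ::
  "'a::euclidean_space set \<Rightarrow> ('a \<Rightarrow> 'a measure) \<Rightarrow> 'a set \<Rightarrow> ('a \<Rightarrow> real) \<Rightarrow> 'a \<Rightarrow> real" where
  "nonlocal \<Omega> \<nu> D u y = (LINT z:nonlocal_set \<Omega> D y|\<nu> y. u (y + z) - u y)"

definition hfun :: "real \<Rightarrow> real \<Rightarrow> real \<Rightarrow> real" where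
  "hfun \<beta> \<sigma> \<delta> =
     (if \<beta> < \<sigma> then \<delta> powr (\<beta> - \<sigma>) else if \<beta> = \<sigma> then \<bar>ln \<delta>\<bar> + 1 else 1)"

definition M0_1 :: "'a::euclidean_space set \<Rightarrow> ('a \<Rightarrow> 'a measure) \<Rightarrow> bool" where
  "M0_1 \<Omega> \<nu> \<longleftrightarrow> (\<Union>x\<in>closure \<Omega>. (+) x ` measure_support (\<nu> x)) \<subseteq> closure \<Omega>"

text \<open>Elements of \<open>L\<^sup>\<infinity>\<close> are taken to be bounded Borel functions, not classes modulo Lebesgue-null
  sets: they are integrated against \<open>\<nu> y\<close>, which need not be absolutely continuous.
  Well-definedness of \<open>I(u,x)\<close> is integrability.\<close>

definition M0_2 :: "'a::euclidean_space set \<Rightarrow> ('a \<Rightarrow> 'a measure) \<Rightarrow> bool" where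
  "M0_2 \<Omega> \<nu> \<longleftrightarrow>
     (\<forall>x\<in>closure \<Omega>. \<forall>r>0. \<forall>u Du.
        u \<in> borel_measurable (restrict_space borel (closure \<Omega>)) \<and> bounded (u ` closure \<Omega>) \<and>
        C1_on (ball x r \<inter> closure \<Omega>) u Du \<longrightarrow>
          set_integrable (\<nu> x) (nonlocal_set \<Omega> UNIV x) (\<lambda>z. u (x + z) - u x) \<and>
          (\<forall>D\<in>sets borel. continuous_on (ball x r \<inter> closure \<Omega>) (nonlocal \<Omega> \<nu> D u)))"

definition M0 :: "'a::euclidean_space set \<Rightarrow> ('a \<Rightarrow> 'a measure) \<Rightarrow> bool" where
  "M0 \<Omega> \<nu> \<longleftrightarrow> M0_1 \<Omega> \<nu> \<and> M0_2 \<Omega> \<nu>"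

definition M1 :: "'a::euclidean_space set \<Rightarrow> ('a \<Rightarrow> 'a measure) \<Rightarrow> real \<Rightarrow> bool" where
  "M1 \<Omega> \<nu> \<sigma> \<longleftrightarrow>
     (\<exists>C\<^sub>1>0. \<forall>\<beta>\<in>{0..2}. \<forall>\<delta>>0.
        (SUP x\<in>closure \<Omega>. \<integral>\<^sup>+z\<in>- ball 0 \<delta>. ennreal (min 1 (norm z powr \<beta>)) \<partial>\<nu> x)
          \<le> ennreal (C\<^sub>1 * hfun \<beta> \<sigma> \<delta>))"

definition M2 :: "'a::euclidean_space set \<Rightarrow> ('a \<Rightarrow> 'a measure) \<Rightarrow> real \<Rightarrow> bool" where
  "M2 \<Omega> \<nu> \<sigma> \<longleftrightarrow>
     (\<exists>C\<^sub>2>0. \<forall>\<beta>\<in>{\<sigma><..2}. \<forall>\<delta>\<in>{0<..<1}.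
        (SUP x\<in>closure \<Omega>. \<integral>\<^sup>+z\<in>ball 0 \<delta>. ennreal (norm z powr \<beta>) \<partial>\<nu> x)
          \<le> ennreal (C\<^sub>2 * \<delta> powr (\<beta> - \<sigma>)))"

text \<open>The measures are restricted to the complement of the ball before subtracting; there they are
  finite by (M1), whereas on the whole space the difference may be undefined.\<close>

definition M3 :: "'a::euclidean_space set \<Rightarrow> ('a \<Rightarrow> 'a measure) \<Rightarrow> real \<Rightarrow> bool" where
  "M3 \<Omega> \<nu> \<sigma> \<longleftrightarrow>
     (\<forall>\<beta>>0. \<exists>\<omega>. modulus_of_continuity \<omega> \<and>
        (\<forall>x\<in>closure \<Omega>. \<forall>y\<in>closure \<Omega>. \<forall>\<delta>>0.
           (\<integral>\<^sup>+z. ennreal (norm z powr \<beta>)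
              \<partial>total_variation_diff (restrict_space (\<nu> x) (- ball 0 \<delta>))
                                     (restrict_space (\<nu> y) (- ball 0 \<delta>)))
             \<le> ennreal ((1 + hfun \<beta> \<sigma> \<delta>) * \<omega> (dist x y))))"

primrec reach :: "('a::euclidean_space \<Rightarrow> 'a measure) \<Rightarrow> 'a \<Rightarrow> nat \<Rightarrow> 'a set" where
  "reach \<nu> x 0 = {x}"
| "reach \<nu> x (Suc n) = (\<Union>\<xi>\<in>reach \<nu> x n. (+) \<xi> ` measure_support (\<nu> \<xi>))"

definition iterative_covering :: "'a::euclidean_space set \<Rightarrow> ('a \<Rightarrow> 'a measure) \<Rightarrow> bool" where
  "iterative_covering \<Omega> \<nu> \<longleftrightarrow> (\<forall>x\<in>closure \<Omega>. closure (\<Union>n. reach \<nu> x n) = closure \<Omega>)"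


subsection \<open>The Hamiltonian and viscosity solutions\<close>

definition H2 :: "'a::euclidean_space set \<Rightarrow> ('a \<Rightarrow> 'a \<Rightarrow> real) \<Rightarrow> real \<Rightarrow> bool" where
  "H2 \<Omega> H m \<longleftrightarrow>
     (\<exists>c>0. \<exists>C\<ge>0. \<forall>x\<in>closure \<Omega>. \<forall>p. H x p \<ge> c * norm p powr m - C)"

definition visc_subsolution ::
  "'a::euclidean_space set \<Rightarrow> ('a \<Rightarrow> 'a measure) \<Rightarrow> ('a \<Rightarrow> 'a \<Rightarrow> real) \<Rightarrow> real \<Rightarrow> 'a set
     \<Rightarrow> ('a \<Rightarrow> real) \<Rightarrow> bool" where
  "visc_subsolution \<Omega> \<nu> H c S u \<longleftrightarrow>
     (\<forall>\<phi> D\<phi> \<delta>. C1_on (closure \<Omega>) \<phi> D\<phi> \<and> \<delta> > 0 \<longrightarrow>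
        (\<forall>x\<^sub>0\<in>S. (\<forall>y\<in>closure \<Omega>. u y - \<phi> y \<le> u x\<^sub>0 - \<phi> x\<^sub>0) \<longrightarrow>
           - nonlocal \<Omega> \<nu> (ball 0 \<delta>) \<phi> x\<^sub>0 - nonlocal \<Omega> \<nu> (- ball 0 \<delta>) u x\<^sub>0 + H x\<^sub>0 (D\<phi> x\<^sub>0) \<le> c))"

definition visc_supersolution ::
  "'a::euclidean_space set \<Rightarrow> ('a \<Rightarrow> 'a measure) \<Rightarrow> ('a \<Rightarrow> 'a \<Rightarrow> real) \<Rightarrow> real \<Rightarrow> 'a set
     \<Rightarrow> ('a \<Rightarrow> real) \<Rightarrow> bool" where
  "visc_supersolution \<Omega> \<nu> H c S u \<longleftrightarrow>
     (\<forall>\<phi> D\<phi> \<delta>. C1_on (closure \<Omega>) \<phi> D\<phi> \<and> \<delta> > 0 \<longrightarrow>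
        (\<forall>x\<^sub>0\<in>S. (\<forall>y\<in>closure \<Omega>. u x\<^sub>0 - \<phi> x\<^sub>0 \<le> u y - \<phi> y) \<longrightarrow>
           - nonlocal \<Omega> \<nu> (ball 0 \<delta>) \<phi> x\<^sub>0 - nonlocal \<Omega> \<nu> (- ball 0 \<delta>) u x\<^sub>0 + H x\<^sub>0 (D\<phi> x\<^sub>0) \<ge> c))"

definition state_constraint_solution ::
  "'a::euclidean_space set \<Rightarrow> ('a \<Rightarrow> 'a measure) \<Rightarrow> ('a \<Rightarrow> 'a \<Rightarrow> real) \<Rightarrow> real
     \<Rightarrow> ('a \<Rightarrow> real) \<Rightarrow> bool" where
  "state_constraint_solution \<Omega> \<nu> H c u \<longleftrightarrow>
     continuous_on (closure \<Omega>) u \<and>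
     visc_subsolution \<Omega> \<nu> H c \<Omega> u \<and>
     visc_supersolution \<Omega> \<nu> H c (closure \<Omega>) u"

definition has_lipschitz_solution ::
  "'a::euclidean_space set \<Rightarrow> ('a \<Rightarrow> 'a measure) \<Rightarrow> ('a \<Rightarrow> 'a \<Rightarrow> real) \<Rightarrow> real \<Rightarrow> bool" where
  "has_lipschitz_solution \<Omega> \<nu> H c \<longleftrightarrow>
     (\<exists>u L. state_constraint_solution \<Omega> \<nu> H c u \<and> L-lipschitz_on (closure \<Omega>) u)"

definition unique_ergodic_constant ::
  "'a::euclidean_space set \<Rightarrow> ('a \<Rightarrow> 'a measure) \<Rightarrow> ('a \<Rightarrow> 'a \<Rightarrow> real) \<Rightarrow> real \<Rightarrow> bool" where
  "unique_ergodic_constant \<Omega> \<nu> H c \<longleftrightarrow>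
     has_lipschitz_solution \<Omega> \<nu> H c \<and> (\<forall>c'. has_lipschitz_solution \<Omega> \<nu> H c' \<longrightarrow> c' = c)"

end

theory Submission
  imports Defs
begin

text \<open>It suffices to compare an arbitrary solution \<open>u\<close> with the Lipschitz solution \<open>w\<close>. At a
  maximum point \<open>a\<close> of \<open>w - u\<close> over the closed domain, double the variables with the penalisation
  \<open>|(x - y)/\<epsilon> - e|\<^sup>2 + |y - a|\<^sup>2\<close>, where \<open>e\<close> points into \<open>\<Omega>\<close>. Then the \<open>x\<close>-variable of the maximum
  point lies in \<open>\<Omega>\<close>, where \<open>w\<close> is a subsolution and where its Lipschitz constant bounds the gradient
  of the test function, so the difference of the Hamiltonians vanishes as \<open>\<epsilon> \<rightarrow> 0\<close>. Moreover, near
  \<open>a\<close> the closed domain is mapped into \<open>\<Omega>\<close> by the translation by \<open>x - y\<close>, so the Lipschitz bound on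
  \<open>w\<close> gives a one-sided one on \<open>u\<close> at \<open>y\<close>, and jumps of size less than \<open>r\<close> contribute only
  \<open>O(r powr (1 - \<sigma>))\<close>, uniformly in \<open>\<epsilon>\<close>. The contribution of the large jumps is continuous in the
  base point. Letting \<open>\<epsilon> \<rightarrow> 0\<close> and then \<open>r \<rightarrow> 0\<close> shows that \<open>w - u\<close> equals its maximum \<open>\<nu> a\<close>-almost
  everywhere on \<open>a + supp (\<nu> a)\<close>, hence everywhere there, and the maximum propagates to the whole
  closed domain by iterative covering.\<close>

section \<open>Geometry of the domain: Lipschitz graphs and inward cones\<close>

lemma C1_on_imp_lipschitz_on:
  fixes g :: "'a::euclidean_space \<Rightarrow> real"
  assumes "C1_on S g Dg" "compact S" "convex S"
  obtains K where "K-lipschitz_on S g"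
proof -
  have der: "\<And>x. x \<in> S \<Longrightarrow> (g has_derivative (\<lambda>h. Dg x \<bullet> h)) (at x within S)"
    and cont: "continuous_on S Dg"
    using assms(1) by (auto simp: C1_on_def)
  have "bounded (Dg ` S)"
    using compact_continuous_image[OF cont assms(2)] compact_imp_bounded by blast
  then obtain K where K: "K > 0" "\<And>x. x \<in> S \<Longrightarrow> norm (Dg x) \<le> K"
    unfolding bounded_pos by auto
  have "onorm (\<lambda>h. Dg x \<bullet> h) \<le> K" if "x \<in> S" for x
  proof (rule onorm_le)
    fix h :: 'a
    have "norm (Dg x \<bullet> h) \<le> norm (Dg x) * norm h"
      using Cauchy_Schwarz_ineq2[of "Dg x" h] by simp
    also have "\<dots> \<le> K * norm h"
      using K(2)[OF that] by (simp add: mult_right_mono)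
    finally show "norm (Dg x \<bullet> h) \<le> K * norm h" .
  qed
  then have "norm (g x - g y) \<le> K * norm (x - y)" if "x \<in> S" "y \<in> S" for x y
    using differentiable_bound[OF assms(3) der] that by blast
  then have "K-lipschitz_on S g"
    using K(1) by (intro lipschitz_onI) (auto simp: dist_norm)
  then show ?thesis ..
qed

text \<open>At an interior point every short displacement stays inside, so \<open>e = 0\<close> and
  \<open>s = 1\<close> serve. At a boundary point \<open>e\<close> is the graph direction: a
  displacement close to a multiple of \<open>e\<close> gains height faster than the Lipschitz graph
  can rise. One cone serves all nearby base points of the closure, so that later a single
  translation can be applied at all of them.\<close>

lemma inward_cone:
  fixes \<Omega> :: "'a::euclidean_space set"
  assumes "open \<Omega>" "C1_boundary \<Omega>" "x \<in> closure \<Omega>"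
  obtains e s r where "norm e \<le> 1" "0 < s" "0 < r"
    and "\<And>y t \<eta>. y \<in> closure \<Omega> \<Longrightarrow> dist y x < r \<Longrightarrow> 0 < t \<Longrightarrow> t < r \<Longrightarrow> norm (\<eta> - e) < s \<Longrightarrow>
           y + t *\<^sub>R \<eta> \<in> \<Omega>"
proof (cases "x \<in> \<Omega>")
  case True
  then obtain R where R: "R > 0" "ball x R \<subseteq> \<Omega>"
    using assms(1) open_contains_ball by blast
  have "y + t *\<^sub>R \<eta> \<in> \<Omega>" if "dist y x < R/2" "0 < t" "t < R/2" "norm \<eta> < 1" for y \<eta> :: 'a and t
  proof -
    have "norm (t *\<^sub>R \<eta>) < R/2 * 1"
      unfolding norm_scaleR using that R by (intro mult_strict_mono') auto
    moreover have "norm (y + t *\<^sub>R \<eta> - x) \<le> norm (y - x) + norm (t *\<^sub>R \<eta>)"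
      using norm_triangle_ineq[of "y - x" "t *\<^sub>R \<eta>"] by (simp add: algebra_simps)
    ultimately have "dist x (y + t *\<^sub>R \<eta>) < R"
      using that(1) by (simp add: dist_norm norm_minus_commute)
    then show ?thesis using R by auto
  qed
  then show ?thesis
    using that[of 0 1 "R/2"] R(1) by auto
next
  case False
  then have "x \<in> frontier \<Omega>"
    using assms by (simp add: frontier_def interior_open)
  then obtain R e g Dg where R: "R > 0" "norm e = 1" "C1_on UNIV g Dg"
    and graph: "\<Omega> \<inter> ball x R = {y \<in> ball x R. g (y - (y \<bullet> e) *\<^sub>R e) < y \<bullet> e}"
    using assms(2) unfolding C1_boundary_def by blast
  \<comment> \<open>Orthogonal projection onto the hyperplane normal to \<open>e\<close>, linear and
    1-Lipschitz; inside the ball, \<Omega> is the set where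
    \<open>g (P y) < y \<bullet> e\<close>.\<close>
  define P where "P y = y - (y \<bullet> e) *\<^sub>R e" for y :: 'a
  have ee: "e \<bullet> e = 1" using R(2) by (simp add: dot_square_norm)
  have P_diff: "P y - P z = P (y - z)" for y z
    by (simp add: P_def algebra_simps inner_diff_left)
  have P_norm: "norm (P y) \<le> norm y" for y
  proof -
    have "(norm (P y))\<^sup>2 = (norm y)\<^sup>2 - (y \<bullet> e)\<^sup>2"
      unfolding power2_norm_eq_inner P_def
      by (simp add: inner_diff_left inner_diff_right ee inner_commute power2_eq_square)
    then have "(norm (P y))\<^sup>2 \<le> (norm y)\<^sup>2" by simp
    then show ?thesis by (rule power2_le_imp_le) simp
  qed
  have "C1_on (cball (P x) R) g Dg"
    using R(3) unfolding C1_on_def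
    by (auto intro: has_derivative_at_withinI continuous_on_subset)
  then obtain K where K: "K-lipschitz_on (cball (P x) R) g"
    using C1_on_imp_lipschitz_on[OF _ compact_cball convex_cball] by blast
  have K0: "K \<ge> 0" using K by (rule lipschitz_on_nonneg)
  have P_ball: "P y \<in> cball (P x) R" if "y \<in> ball x R" for y
    using P_norm[of "x - y"] that by (auto simp: dist_norm P_diff)
  \<comment> \<open>The ball is open, so a point of the closure inside it is a limit of points of
    \<open>\<Omega> \<inter> ball x R\<close>; the strict graph inequality passes to the limit as a
    weak one.\<close>
  have above: "g (P y) \<le> y \<bullet> e" if "y \<in> closure \<Omega>" "y \<in> ball x R" for y
  proof -
    have "continuous_on UNIV g"
      using R(3) unfolding C1_on_def by (auto intro: has_derivative_continuous_on)
    then have "continuous_on UNIV (\<lambda>y. g (P y))"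
      by (rule continuous_on_compose2) (auto simp: P_def intro!: continuous_intros)
    then have "closed {y. g (P y) \<le> y \<bullet> e}"
      by (intro closed_Collect_le continuous_intros)
    moreover have "\<Omega> \<inter> ball x R \<subseteq> {y. g (P y) \<le> y \<bullet> e}"
      unfolding graph P_def by auto
    ultimately have "closure (\<Omega> \<inter> ball x R) \<subseteq> {y. g (P y) \<le> y \<bullet> e}"
      by (intro closure_minimal)
    moreover have "y \<in> closure (\<Omega> \<inter> ball x R)"
      using open_Int_closure_subset[of "ball x R" \<Omega>] that by (auto simp: Int_commute)
    ultimately show ?thesis by auto
  qed
  \<comment> \<open>Moving by \<open>t *\<^sub>R \<eta>\<close> changes the graph height by at most
    \<open>K * (t * s)\<close> and raises the point by at least \<open>t * (1 - s)\<close>; this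
    \<open>s\<close> makes the second quantity the larger one.\<close>
  define s where "s = 1 / (K + 2)"
  have s: "0 < s" "s < 1" "K * s < 1 - s"
    using K0 by (auto simp: s_def field_simps)
  have "y + t *\<^sub>R \<eta> \<in> \<Omega>"
    if y: "y \<in> closure \<Omega>" "dist y x < R/3" and t: "0 < t" "t < R/3" and \<eta>: "norm (\<eta> - e) < s"
    for y \<eta> :: 'a and t
  proof -
    have n2: "norm \<eta> < 2"
      using norm_triangle_ineq[of "\<eta> - e" e] \<eta> s R(2) by simp
    have "norm (t *\<^sub>R \<eta>) < R/3 * 2"
      unfolding norm_scaleR using t n2 R by (intro mult_strict_mono') auto
    moreover have "norm (y + t *\<^sub>R \<eta> - x) \<le> norm (y - x) + norm (t *\<^sub>R \<eta>)"
      using norm_triangle_ineq[of "y - x" "t *\<^sub>R \<eta>"] by (simp add: algebra_simps)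
    ultimately have b: "y + t *\<^sub>R \<eta> \<in> ball x R"
      using y(2) by (simp add: dist_norm norm_minus_commute)
    have yb: "y \<in> ball x R" using y(2) R(1) by (simp add: dist_commute)
    have "P (y + t *\<^sub>R \<eta>) - P y = t *\<^sub>R P (\<eta> - e)"
      unfolding P_diff P_def by (simp add: algebra_simps inner_diff_left ee)
    then have "dist (P (y + t *\<^sub>R \<eta>)) (P y) \<le> t * s"
      using P_norm[of "\<eta> - e"] \<eta> t by (simp add: dist_norm mult_left_mono)
    moreover have "dist (g (P (y + t *\<^sub>R \<eta>))) (g (P y)) \<le> K * dist (P (y + t *\<^sub>R \<eta>)) (P y)"
      using K P_ball[OF b] P_ball[OF yb] by (rule lipschitz_onD)
    ultimately have "dist (g (P (y + t *\<^sub>R \<eta>))) (g (P y)) \<le> K * (t * s)"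
      using K0 by (meson mult_left_mono order_trans)
    then have "g (P (y + t *\<^sub>R \<eta>)) \<le> y \<bullet> e + t * (K * s)"
      using above[OF y(1) yb] by (simp add: dist_real_def algebra_simps)
    also have "\<dots> < y \<bullet> e + t * (1 - s)"
      using s t by (simp add: mult_strict_left_mono)
    also have "\<dots> \<le> y \<bullet> e + t * (\<eta> \<bullet> e)"
    proof -
      have "\<bar>(\<eta> - e) \<bullet> e\<bar> \<le> norm (\<eta> - e) * norm e" by (rule Cauchy_Schwarz_ineq2)
      then have "1 - s \<le> \<eta> \<bullet> e" using \<eta> R(2) by (simp add: inner_diff_left ee)
      then show ?thesis using t by (simp add: mult_left_mono)
    qed
    finally have "g (P (y + t *\<^sub>R \<eta>)) < (y + t *\<^sub>R \<eta>) \<bullet> e" by (simp add: inner_add_left)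
    then have "y + t *\<^sub>R \<eta> \<in> \<Omega> \<inter> ball x R"
      unfolding graph using b by (simp add: P_def)
    then show ?thesis by blast
  qed
  then show ?thesis
    using that[of e s "R/3"] s R by auto
qed

section \<open>Polynomial and quadratic test functions, gradients at touching points\<close>

text \<open>Makes (M0-2) applicable to the polynomials that approximate a continuous
  function.\<close>

lemma real_polynomial_function_C1:
  fixes f :: "'a::euclidean_space \<Rightarrow> real"
  assumes "real_polynomial_function f"
  shows "\<exists>Df. C1_on UNIV f Df"
  using assms
proof induction
  case (linear f)
  define a where "a = (\<Sum>b\<in>Basis. f b *\<^sub>R b)"
  interpret bounded_linear f by (rule linear)
  have "f h = a \<bullet> h" for h
  proof -
    have "f h = f (\<Sum>b\<in>Basis. (h \<bullet> b) *\<^sub>R b)" by (simp add: euclidean_representation)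
    also have "\<dots> = a \<bullet> h"
      unfolding a_def sum inner_sum_left
      by (intro sum.cong) (auto simp: scale inner_commute)
    finally show ?thesis .
  qed
  then have "f = (\<lambda>h. a \<bullet> h)" by auto
  moreover have "(f has_derivative f) (at x)" for x
    by (rule bounded_linear_imp_has_derivative[OF bounded_linear_axioms])
  ultimately have "C1_on UNIV f (\<lambda>_. a)" unfolding C1_on_def by auto
  then show ?case by blast
next
  case (const c)
  have "C1_on UNIV (\<lambda>_. c) (\<lambda>_. 0::'a)" by (simp add: C1_on_def)
  then show ?case by blast
next
  case (add f g)
  then obtain Df Dg where "C1_on UNIV f Df" "C1_on UNIV g Dg" by blast
  then have "C1_on UNIV (\<lambda>x. f x + g x) (\<lambda>x. Df x + Dg x)"
    unfolding C1_on_def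
    by (auto simp: inner_add_left intro!: has_derivative_add[THEN has_derivative_eq_rhs] continuous_intros)
  then show ?case by blast
next
  case (mult f g)
  then obtain Df Dg where D: "C1_on UNIV f Df" "C1_on UNIV g Dg" by blast
  then have "continuous_on UNIV f" "continuous_on UNIV g"
    unfolding C1_on_def by (auto intro!: has_derivative_continuous_on)
  with D have "C1_on UNIV (\<lambda>x. f x * g x) (\<lambda>x. f x *\<^sub>R Dg x + g x *\<^sub>R Df x)"
    unfolding C1_on_def
    by (auto simp: inner_add_left mult.commute intro!: has_derivative_mult[THEN has_derivative_eq_rhs] continuous_intros)
  then show ?case by blast
qed

text \<open>Freezing one variable of the doubled penalisation leaves a function of this form in the
  other, so both test functions are covered.\<close>

lemma C1_on_sum_square_norm:
  fixes a b :: "'a::euclidean_space"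
  shows "C1_on S (\<lambda>z. \<alpha> * (norm (z - a))\<^sup>2 + \<beta> * (norm (z - b))\<^sup>2)
           (\<lambda>z. (2 * \<alpha>) *\<^sub>R (z - a) + (2 * \<beta>) *\<^sub>R (z - b))"
  unfolding C1_on_def power2_norm_eq_inner
  by (auto intro!: derivative_eq_intros continuous_intros simp: algebra_simps inner_commute)

text \<open>A linear bound in \<open>norm z\<close> suffices for integrability near the origin,
  because \<sigma> < 1.\<close>

lemma sum_square_norm_increment_le:
  fixes a b x z :: "'a::real_inner"
  assumes "norm z \<le> 1"
  shows "\<bar>(\<alpha> * (norm (x + z - a))\<^sup>2 + \<beta> * (norm (x + z - b))\<^sup>2)
            - (\<alpha> * (norm (x - a))\<^sup>2 + \<beta> * (norm (x - b))\<^sup>2)\<bar>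
       \<le> (\<bar>\<alpha>\<bar> * (2 * norm (x - a) + 1) + \<bar>\<beta>\<bar> * (2 * norm (x - b) + 1)) * norm z"
proof -
  have 1: "\<bar>(norm (x + z - c))\<^sup>2 - (norm (x - c))\<^sup>2\<bar> \<le> (2 * norm (x - c) + 1) * norm z" for c
  proof -
    have "(norm (x + z - c))\<^sup>2 - (norm (x - c))\<^sup>2 = 2 * ((x - c) \<bullet> z) + norm z * norm z"
      unfolding power2_norm_eq_inner real_norm_def power2_eq_square[symmetric]
      by (simp add: algebra_simps inner_commute inner_add_left inner_add_right inner_diff_left inner_diff_right)
    moreover have "norm z * norm z \<le> 1 * norm z"
      using assms by (intro mult_right_mono) auto
    moreover have "\<bar>(x - c) \<bullet> z\<bar> \<le> norm (x - c) * norm z" by (rule Cauchy_Schwarz_ineq2)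
    moreover have "0 \<le> norm z * norm z" by simp
    moreover have "(2 * norm (x - c) + 1) * norm z = 2 * (norm (x - c) * norm z) + 1 * norm z"
      by (simp add: algebra_simps)
    ultimately show ?thesis by linarith
  qed
  have "\<bar>\<alpha> * ((norm (x + z - a))\<^sup>2 - (norm (x - a))\<^sup>2) + \<beta> * ((norm (x + z - b))\<^sup>2 - (norm (x - b))\<^sup>2)\<bar>
     \<le> \<bar>\<alpha>\<bar> * \<bar>(norm (x + z - a))\<^sup>2 - (norm (x - a))\<^sup>2\<bar> + \<bar>\<beta>\<bar> * \<bar>(norm (x + z - b))\<^sup>2 - (norm (x - b))\<^sup>2\<bar>"
    by (metis abs_mult abs_triangle_ineq)
  also have "\<dots> \<le> \<bar>\<alpha>\<bar> * ((2 * norm (x - a) + 1) * norm z) + \<bar>\<beta>\<bar> * ((2 * norm (x - b) + 1) * norm z)"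
    using 1 by (intro add_mono mult_left_mono) auto
  finally show ?thesis by (simp add: algebra_simps)
qed

text \<open>Increments of \<phi> from \<open>x\<close> dominate those of \<open>w\<close>, so along
  \<open>- D\<phi> x\<close> the function \<phi> falls at a rate of at most
  \<open>L * norm (D\<phi> x)\<close>; its actual rate is the square of that norm. Interiority of
  \<open>x\<close> makes this direction admissible, which is one reason for keeping the first
  doubled variable inside \<Omega>.\<close>

lemma lipschitz_touching_gradient_le:
  fixes w :: "'a::euclidean_space \<Rightarrow> real"
  assumes "L-lipschitz_on (closure \<Omega>) w" "open \<Omega>" "x \<in> \<Omega>"
    and C1: "C1_on (closure \<Omega>) \<phi> D\<phi>"
    and max: "\<And>y. y \<in> closure \<Omega> \<Longrightarrow> w y - \<phi> y \<le> w x - \<phi> x"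
  shows "norm (D\<phi> x) \<le> L"
proof (cases "D\<phi> x = 0")
  case True
  then show ?thesis using lipschitz_on_nonneg[OF assms(1)] by simp
next
  case False
  define p where "p = D\<phi> x"
  have xc: "x \<in> closure \<Omega>" using assms(3) closure_subset by blast
  obtain R where R: "R > 0" "ball x R \<subseteq> \<Omega>" using assms(2,3) open_contains_ball by blast
  have "(\<phi> has_derivative (\<lambda>h. p \<bullet> h)) (at x within closure \<Omega>)"
    using C1 xc by (auto simp: C1_on_def p_def)
  then have "(\<phi> has_derivative (\<lambda>h. p \<bullet> h)) (at x)"
    using at_within_interior[of x "closure \<Omega>"] assms(2,3) interior_maximal[OF closure_subset assms(2)] by auto
  then have d: "(\<phi> has_derivative (\<lambda>h. p \<bullet> h)) (at (x + 0 *\<^sub>R (- p)))" by simp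
  have "((\<lambda>t. x + t *\<^sub>R (- p)) has_derivative (\<lambda>t. t *\<^sub>R (- p))) (at 0)"
    by (auto intro!: derivative_eq_intros)
  from has_derivative_compose[OF this d]
  have "((\<lambda>t. \<phi> (x + t *\<^sub>R (- p))) has_real_derivative (- (p \<bullet> p))) (at 0)"
    unfolding has_field_derivative_def by (rule has_derivative_eq_rhs) (simp add: fun_eq_iff)
  then have "((\<lambda>t. \<phi> (x + t *\<^sub>R (- p))) has_real_derivative (- (p \<bullet> p))) (at 0 within {0<..})"
    by (rule has_field_derivative_at_within)
  then have lim: "((\<lambda>t. (\<phi> (x + t *\<^sub>R (- p)) - \<phi> x) / t) \<longlongrightarrow> - (p \<bullet> p)) (at_right 0)"
    by (simp add: has_field_derivative_iff)
  have pos: "norm p > 0" using False by (simp add: p_def)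
  have "- (L * norm p) \<le> - (p \<bullet> p)"
  proof (rule tendsto_lowerbound[OF lim])
    show "eventually (\<lambda>t. - (L * norm p) \<le> (\<phi> (x + t *\<^sub>R (- p)) - \<phi> x) / t) (at_right 0)"
      unfolding eventually_at_right_field
    proof (intro exI[of _ "R / norm p"] conjI allI impI)
      show "0 < R / norm p" using R pos by simp
      fix t assume t: "0 < t" "t < R / norm p"
      then have "norm (t *\<^sub>R p) < R" using pos by (simp add: field_simps)
      then have "x + t *\<^sub>R (- p) \<in> ball x R" by (simp add: dist_norm)
      then have "x + t *\<^sub>R (- p) \<in> closure \<Omega>"
        using R(2) closure_subset by blast
      from max[OF this] lipschitz_onD[OF assms(1) xc this]
      have "\<phi> (x + t *\<^sub>R (- p)) - \<phi> x \<ge> - (L * (t * norm p))"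
        using t by (simp add: dist_norm)
      then show "- (L * norm p) \<le> (\<phi> (x + t *\<^sub>R (- p)) - \<phi> x) / t"
        using t by (simp add: field_simps)
    qed
  qed simp
  then show ?thesis
    using pos by (simp add: dot_square_norm power2_eq_square p_def)
qed

section \<open>Doubling of variables at a maximum point\<close>

text \<open>The radius \<rho> is fixed before \<theta>, so the one-sided Lipschitz bound on
  \<open>u\<close> holds on a range of jumps that does not shrink as the doubled points approach
  \<open>a\<close>. This bound replaces a Lipschitz assumption on \<open>u\<close>.\<close>

lemma doubling_of_variables:
  fixes w u :: "'a::euclidean_space \<Rightarrow> real"
  assumes \<Omega>: "open \<Omega>" "bounded \<Omega>" "C1_boundary \<Omega>"
    and w: "L-lipschitz_on (closure \<Omega>) w" and u: "continuous_on (closure \<Omega>) u"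
    and a: "a \<in> closure \<Omega>" and max: "\<And>x. x \<in> closure \<Omega> \<Longrightarrow> w x - u x \<le> w a - u a"
  obtains \<rho> where "0 < \<rho>"
    and "\<forall>\<theta>>0. \<exists>x\<in>\<Omega>. \<exists>y\<in>closure \<Omega>. \<exists>A b. dist x a < \<theta> \<and> dist y a < \<theta> \<and>
           (\<forall>x'\<in>closure \<Omega>. \<forall>y'\<in>closure \<Omega>.
              w x' - u y' - A * (norm (x' - y' - b))\<^sup>2 - (norm (y' - a))\<^sup>2
            \<le> w x - u y - A * (norm (x - y - b))\<^sup>2 - (norm (y - a))\<^sup>2) \<and>
           (\<forall>z. norm z < \<rho> \<longrightarrow> y + z \<in> closure \<Omega> \<longrightarrow> - (L + 3) * norm z \<le> u (y + z) - u y)"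
proof -
  obtain e s r where e: "norm e \<le> 1" "0 < s" "0 < r"
    and cone: "\<And>y t \<eta>. y \<in> closure \<Omega> \<Longrightarrow> dist y a < r \<Longrightarrow> 0 < t \<Longrightarrow> t < r \<Longrightarrow> norm (\<eta> - e) < s \<Longrightarrow>
                 y + t *\<^sub>R \<eta> \<in> \<Omega>"
    using inward_cone[OF \<Omega>(1,3) a] by blast
  \<comment> \<open>The distance from \<open>y\<close> to \<open>a\<close> and the jump
    \<open>z\<close> may each use up \<open>r / 2\<close> of the range of the cone; the bound 1
    serves the increment estimate for the squared norm.\<close>
  define \<rho> where "\<rho> = min (r / 2) 1"
  have \<rho>: "0 < \<rho>" "\<rho> \<le> 1" "\<rho> \<le> r / 2" using e by (auto simp: \<rho>_def)
  have L0: "L \<ge> 0" using w by (rule lipschitz_on_nonneg)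
  have cpt: "compact (closure \<Omega>)" using \<Omega>(2) by (simp add: compact_closure)
  have *: "\<exists>x\<in>\<Omega>. \<exists>y\<in>closure \<Omega>. \<exists>A b. dist x a < \<theta> \<and> dist y a < \<theta> \<and>
           (\<forall>x'\<in>closure \<Omega>. \<forall>y'\<in>closure \<Omega>.
              w x' - u y' - A * (norm (x' - y' - b))\<^sup>2 - (norm (y' - a))\<^sup>2
            \<le> w x - u y - A * (norm (x - y - b))\<^sup>2 - (norm (y - a))\<^sup>2) \<and>
           (\<forall>z. norm z < \<rho> \<longrightarrow> y + z \<in> closure \<Omega> \<longrightarrow> - (L + 3) * norm z \<le> u (y + z) - u y)"
    if \<theta>: "0 < \<theta>" for \<theta>
  proof -
    \<comment> \<open>\<kappa> is the bound aimed at for both \<open>norm (y - a)\<close> and the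
      deviation of \<open>(x - y) /\<^sub>R \<epsilon>\<close> from \<open>e\<close>.\<close>
    define \<kappa> where "\<kappa> = min (min s \<rho>) (min (\<theta> / 2) 1)"
    have \<kappa>: "0 < \<kappa>" "\<kappa> \<le> s" "\<kappa> \<le> \<rho>" "\<kappa> \<le> \<theta> / 2" "\<kappa> \<le> 1"
      using \<theta> e \<rho> by (auto simp: \<kappa>_def)
    \<comment> \<open>The last bound yields \<open>3 * L * \<epsilon> < \<kappa>\<^sup>2\<close>,
      strictly even for \<open>L = 0\<close>, which closes the estimate \<open>key\<close>. The
      bound \<open>\<theta> / 5\<close> gives a distance from \<open>x\<close> to \<open>a\<close>
      below \<open>2 * \<theta> / 5 + \<theta> / 2\<close>.\<close>
    define \<epsilon> where "\<epsilon> = min (min (r / 2) (\<theta> / 5)) (\<kappa>\<^sup>2 / (6 * (L + 1)))"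
    have \<epsilon>: "0 < \<epsilon>" "\<epsilon> < r" "\<epsilon> \<le> \<theta> / 5" "3 * L * \<epsilon> < \<kappa>\<^sup>2"
    proof -
      show "0 < \<epsilon>" "\<epsilon> < r" using \<theta> e \<kappa> L0 by (auto simp: \<epsilon>_def)
      show "\<epsilon> \<le> \<theta> / 5" unfolding \<epsilon>_def by (rule min.coboundedI1[OF min.cobounded2])
      have "\<epsilon> \<le> \<kappa>\<^sup>2 / (6 * (L + 1))" by (simp add: \<epsilon>_def)
      then have "6 * (L * \<epsilon>) + 6 * \<epsilon> \<le> \<kappa>\<^sup>2" using L0 by (simp add: field_simps)
      moreover have "0 \<le> L * \<epsilon>" using L0 \<open>0 < \<epsilon>\<close> by simp
      ultimately show "3 * L * \<epsilon> < \<kappa>\<^sup>2" using \<open>0 < \<epsilon>\<close> by simp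
    qed
    define A b where "A = 1 / \<epsilon>\<^sup>2" and "b = \<epsilon> *\<^sub>R e"
    define \<Phi> where "\<Phi> = (\<lambda>(x', y'). w x' - u y' - A * (norm (x' - y' - b))\<^sup>2 - (norm (y' - a))\<^sup>2)"
    have "continuous_on (closure \<Omega> \<times> closure \<Omega>) \<Phi>"
    proof -
      have "continuous_on (closure \<Omega> \<times> closure \<Omega>) (\<lambda>p. w (fst p))"
        by (rule continuous_on_compose2[OF lipschitz_on_continuous_on[OF w]]) (auto intro!: continuous_intros)
      moreover have "continuous_on (closure \<Omega> \<times> closure \<Omega>) (\<lambda>p. u (snd p))"
        by (rule continuous_on_compose2[OF u]) (auto intro!: continuous_intros)
      ultimately show ?thesis
        unfolding \<Phi>_def case_prod_unfold by (intro continuous_intros)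
    qed
    moreover have "compact (closure \<Omega> \<times> closure \<Omega>)" using cpt cpt by (rule compact_Times)
    moreover have "closure \<Omega> \<times> closure \<Omega> \<noteq> {}" using a by auto
    ultimately obtain x y where x: "x \<in> closure \<Omega>" and y: "y \<in> closure \<Omega>"
      and m: "\<And>x' y'. x' \<in> closure \<Omega> \<Longrightarrow> y' \<in> closure \<Omega> \<Longrightarrow> \<Phi> (x', y') \<le> \<Phi> (x, y)"
      using continuous_attains_sup[of "closure \<Omega> \<times> closure \<Omega>" \<Phi>] by auto
    \<comment> \<open>The first penalty at the maximum point is exactly
      \<open>\<tau>\<^sup>2\<close>.\<close>
    define \<tau> where "\<tau> = norm (x - y - b) / \<epsilon>"
    have A\<tau>: "A * (norm (x - y - b))\<^sup>2 = \<tau>\<^sup>2" by (simp add: A_def \<tau>_def power_divide)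
    have \<tau>0: "\<tau> \<ge> 0" using \<epsilon> by (simp add: \<tau>_def)
    have n\<tau>: "norm (x - y - b) = \<epsilon> * \<tau>" using \<epsilon> by (simp add: \<tau>_def)
    have nb: "norm b \<le> \<epsilon>" using e \<epsilon> by (simp add: b_def mult_left_le)
    have nxy: "norm (x - y) \<le> \<epsilon> * \<tau> + \<epsilon>"
      using norm_triangle_ineq[of "x - y - b" b] n\<tau> nb by simp
    \<comment> \<open>Both penalties vanish at the competitor \<open>(a + b, a)\<close>. Comparing
      with it, and using that \<open>w - u\<close> at \<open>y\<close> does not exceed its value at
      \<open>a\<close>, leaves only increments of \<open>w\<close>.\<close>
    have "a + \<epsilon> *\<^sub>R e \<in> \<Omega>" using cone[of a \<epsilon> e] a e \<epsilon> by auto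
    then have ab: "a + b \<in> closure \<Omega>" using closure_subset by (auto simp: b_def)
    have "w (a + b) - w a \<ge> - (L * \<epsilon>)"
      using lipschitz_onD[OF w ab a] nb L0 mult_left_mono[OF nb L0] by (auto simp: dist_norm)
    moreover have "w x - w y \<le> L * (\<epsilon> * \<tau> + \<epsilon>)"
      using lipschitz_onD[OF w x y] mult_left_mono[OF nxy L0] by (auto simp: dist_norm)
    ultimately have key: "\<tau>\<^sup>2 + (norm (y - a))\<^sup>2 \<le> L * \<epsilon> * \<tau> + 2 * (L * \<epsilon>)"
      using m[OF ab a] max[OF y] unfolding \<Phi>_def case_prod_conv A\<tau>
      by (simp add: distrib_left)
    \<comment> \<open>Bootstrap: \<open>key\<close> is quadratic in \<tau> on the left and linear on
      the right, so \<tau> cannot exceed 1; reinserting this gives the finer bound by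
      \<kappa>.\<close>
    have \<tau>1: "\<tau> \<le> 1"
    proof (rule ccontr)
      assume "\<not> \<tau> \<le> 1"
      then have "L * \<epsilon> * 1 \<le> L * \<epsilon> * \<tau>" using L0 \<epsilon> by (intro mult_left_mono) auto
      moreover have "0 \<le> (norm (y - a))\<^sup>2" by simp
      ultimately have "\<tau> * \<tau> \<le> 3 * L * \<epsilon> * \<tau>" using key unfolding power2_eq_square by linarith
      then have "\<tau> \<le> 3 * L * \<epsilon>" using \<open>\<not> \<tau> \<le> 1\<close> by simp
      moreover have "\<kappa>\<^sup>2 \<le> 1" using \<kappa> by (simp add: power_le_one)
      ultimately show False using \<epsilon>(4) \<open>\<not> \<tau> \<le> 1\<close> by simp
    qed
    have "L * \<epsilon> * \<tau> \<le> L * \<epsilon> * 1" using \<tau>1 L0 \<epsilon> by (intro mult_left_mono) auto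
    then have key': "\<tau>\<^sup>2 + (norm (y - a))\<^sup>2 < \<kappa>\<^sup>2" using key \<epsilon>(4) by simp
    have "\<tau> < \<kappa>"
      by (rule power2_less_imp_less) (use key' \<kappa> zero_le_power2[of "norm (y - a)"] in \<open>linarith, simp\<close>)
    have "norm (y - a) < \<kappa>"
      by (rule power2_less_imp_less) (use key' \<kappa> zero_le_power2[of \<tau>] in \<open>linarith, simp\<close>)
    define \<eta> where "\<eta> = (x - y) /\<^sub>R \<epsilon>"
    have xy: "x - y = \<epsilon> *\<^sub>R \<eta>" using \<epsilon> by (simp add: \<eta>_def)
    have "x - y - b = \<epsilon> *\<^sub>R (\<eta> - e)" by (simp add: xy b_def algebra_simps)
    then have "norm (\<eta> - e) = \<tau>" using \<epsilon> by (simp add: \<tau>_def)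
    then have \<eta>s: "norm (\<eta> - e) < s" using \<open>\<tau> < \<kappa>\<close> \<kappa> by simp
    have ya: "dist y a < \<kappa>" using \<open>norm (y - a) < \<kappa>\<close> by (simp add: dist_norm)
    \<comment> \<open>The direction \<eta> lies in the cone, so translation by \<open>x - y\<close>
      maps the closure near \<open>a\<close> into \<Omega>. At \<open>y\<close> itself this puts
      \<open>x\<close> into \<Omega>; at \<open>y + z\<close> it makes \<open>x + z\<close>
      admissible.\<close>
    have shift: "y' + (x - y) \<in> \<Omega>" if "y' \<in> closure \<Omega>" "dist y' a < r" for y'
      using cone[OF that \<epsilon>(1,2) \<eta>s] by (simp add: xy)
    have "dist y a < r" using ya \<kappa>(3) \<rho>(3) e(3) by linarith
    from shift[OF y this] have xin: "x \<in> \<Omega>" by simp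
    have "\<epsilon> * \<tau> \<le> \<epsilon>" using \<tau>1 \<epsilon> by simp
    then have "norm (x - y) \<le> 2 * \<epsilon>" using nxy by linarith
    then have "dist x y \<le> 2 * \<epsilon>" by (simp add: dist_norm)
    then have xa: "dist x a < \<theta>"
      using dist_triangle[of x a y] ya \<kappa>(4) \<epsilon>(3) \<theta> by linarith
    \<comment> \<open>Moving both variables by \<open>z\<close> leaves the first penalty unchanged.
      What remains is an increment of \<open>w\<close>, costing \<open>L\<close>, and one of the
      second penalty, costing 3.\<close>
    have low: "- (L + 3) * norm z \<le> u (y + z) - u y"
      if z: "norm z < \<rho>" "y + z \<in> closure \<Omega>" for z
    proof -
      have "dist (y + z) a \<le> dist y a + norm z"
        using norm_triangle_ineq[of "y - a" z] by (simp add: dist_norm algebra_simps)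
      then have "dist (y + z) a < r" using ya \<kappa>(3) \<rho>(3) z(1) by linarith
      from shift[OF z(2) this] have xz: "x + z \<in> closure \<Omega>"
        using closure_subset by (auto simp: algebra_simps)
      have 1: "w x - w (x + z) \<le> L * norm z"
        using lipschitz_onD[OF w x xz] by (auto simp: dist_norm)
      have "\<bar>(norm (y + z - a))\<^sup>2 - (norm (y - a))\<^sup>2\<bar> \<le> (2 * norm (y - a) + 1) * norm z"
        using sum_square_norm_increment_le[of z 1 y a 0 a] z(1) \<rho>(2) by simp
      also have "\<dots> \<le> 3 * norm z"
        using \<open>norm (y - a) < \<kappa>\<close> \<kappa>(5) by (intro mult_right_mono) auto
      finally have 2: "(norm (y + z - a))\<^sup>2 - (norm (y - a))\<^sup>2 \<le> 3 * norm z" by linarith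
      have "\<Phi> (x + z, y + z) \<le> \<Phi> (x, y)" by (rule m[OF xz z(2)])
      then show ?thesis
        using 1 2 by (simp add: \<Phi>_def algebra_simps)
    qed
    have "dist y a < \<theta>" using ya \<kappa>(4) \<theta> by linarith
    then show ?thesis
      using xin y xa m low unfolding \<Phi>_def by (intro bexI[of _ x] bexI[of _ y] exI[of _ A] exI[of _ b]) auto
  qed
  show ?thesis by (rule that[OF \<rho>(1)]) (intro allI impI, rule *)
qed

section \<open>Estimates of the nonlocal operator over small and large jumps\<close>

text \<open>Removes an error in the limit of small radii; \<open>K\<close> may be arbitrarily large
  as long as it does not depend on \<delta>.\<close>

lemma le_if_le_add_powr:
  fixes X Y K s r :: real
  assumes "0 < r" "0 < s" "\<And>\<delta>. 0 < \<delta> \<Longrightarrow> \<delta> < r \<Longrightarrow> X \<le> Y + K * \<delta> powr s"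
  shows "X \<le> Y"
proof (rule tendsto_lowerbound)
  have nonneg: "\<forall>\<^sub>F \<delta>::real in at_right 0. 0 \<le> \<delta>"
    by (auto simp: eventually_at_right_field intro: exI[of _ 1])
  have "((\<lambda>\<delta>. \<delta> powr s) \<longlongrightarrow> 0) (at_right 0)"
    by (rule tendsto_zero_powrI[OF tendsto_ident_at tendsto_const nonneg assms(2)])
  then show "((\<lambda>\<delta>. Y + K * \<delta> powr s) \<longlongrightarrow> Y) (at_right 0)"
    using tendsto_add[OF tendsto_const[of Y] tendsto_mult[OF tendsto_const[of K]]] by fastforce
  show "\<forall>\<^sub>F \<delta> in at_right 0. X \<le> Y + K * \<delta> powr s"
    using assms by (auto simp: eventually_at_right_field)
qed simp

text \<open>The bounds \<open>tail\<close> and \<open>near\<close> are (M1) at \<beta> = 0 and (M2)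
  at \<beta> = 1, the latter admissible because \<sigma> < 1. Lipschitz increments are thus
  integrable near the origin without a gradient correction, and their integral tends to 0 with the
  radius.\<close>

locale order_below_one_measures =
  fixes \<Omega> :: "'a::euclidean_space set" and \<nu> :: "'a \<Rightarrow> 'a measure" and \<sigma> C\<^sub>1 C\<^sub>2 :: real
  assumes bounded_\<Omega>: "bounded \<Omega>"
    and sets_\<nu>: "\<And>x. x \<in> closure \<Omega> \<Longrightarrow> sets (\<nu> x) = sets borel"
    and \<sigma>: "\<sigma> < 1"
    and C_nonneg: "0 \<le> C\<^sub>1" "0 \<le> C\<^sub>2"
    and tail: "\<And>x \<delta>. x \<in> closure \<Omega> \<Longrightarrow> 0 < \<delta> \<Longrightarrow>
                 emeasure (\<nu> x) (- ball 0 \<delta>) \<le> ennreal (C\<^sub>1 * \<delta> powr - \<sigma>)"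
    and near: "\<And>x \<delta>. x \<in> closure \<Omega> \<Longrightarrow> 0 < \<delta> \<Longrightarrow> \<delta> < 1 \<Longrightarrow>
                 (\<integral>\<^sup>+z\<in>ball 0 \<delta>. ennreal (norm z) \<partial>\<nu> x) \<le> ennreal (C\<^sub>2 * \<delta> powr (1 - \<sigma>))"
begin

lemma compact_closure_\<Omega>: "compact (closure \<Omega>)"
  using bounded_\<Omega> by (simp add: compact_closure)

lemma nonlocal_set_borel:
  assumes "D \<in> sets borel"
  shows "nonlocal_set \<Omega> D y \<in> sets borel"
proof -
  have "closed ((\<lambda>z. y + z) -` closure \<Omega>)"
    by (intro closed_vimage continuous_intros) auto
  then have "D \<inter> (\<lambda>z. y + z) -` closure \<Omega> \<in> sets borel"
    using assms by auto
  moreover have "nonlocal_set \<Omega> D y = D \<inter> (\<lambda>z. y + z) -` closure \<Omega>"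
    by (auto simp: nonlocal_set_def)
  ultimately show ?thesis by simp
qed

lemma increment_measurable:
  fixes f :: "'a \<Rightarrow> real"
  assumes "continuous_on (closure \<Omega>) f" "y \<in> closure \<Omega>" "D \<in> sets borel"
  shows "(\<lambda>z. indicator (nonlocal_set \<Omega> D y) z *\<^sub>R (f (y + z) - f y)) \<in> borel_measurable (\<nu> y)"
proof -
  have "continuous_on (nonlocal_set \<Omega> D y) (\<lambda>z. f (y + z))"
    by (rule continuous_on_compose2[OF assms(1)])
       (auto simp: nonlocal_set_def intro!: continuous_intros)
  then have "(\<lambda>z. indicator (nonlocal_set \<Omega> D y) z *\<^sub>R (f (y + z) - f y)) \<in> borel_measurable borel"
    using nonlocal_set_borel[OF assms(3)]
    by (intro borel_measurable_continuous_on_indicator continuous_on_diff continuous_on_const) auto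
  then show ?thesis using sets_\<nu>[OF assms(2)] by (simp cong: measurable_cong_sets)
qed

lemma integral_norm_near_zero:
  assumes "y \<in> closure \<Omega>" "0 < r" "r < 1"
  shows "integrable (\<nu> y) (\<lambda>z. indicator (ball 0 r) z * norm z)"
    and "(\<integral>z. indicator (ball 0 r) z * norm z \<partial>\<nu> y) \<le> C\<^sub>2 * r powr (1 - \<sigma>)"
proof -
  have eq: "(\<integral>\<^sup>+z. ennreal (indicator (ball 0 r) z * norm z) \<partial>\<nu> y) = (\<integral>\<^sup>+z\<in>ball 0 r. ennreal (norm z) \<partial>\<nu> y)"
    by (intro nn_integral_cong) (auto split: split_indicator)
  have le: "(\<integral>\<^sup>+z. ennreal (indicator (ball 0 r) z * norm z) \<partial>\<nu> y) \<le> ennreal (C\<^sub>2 * r powr (1 - \<sigma>))"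
    unfolding eq by (rule near[OF assms])
  have meas: "(\<lambda>z. indicator (ball 0 r) z * norm z) \<in> borel_measurable (\<nu> y)"
    using sets_\<nu>[OF assms(1)] by (intro borel_measurable_times borel_measurable_indicator)
      (auto simp: measurable_cong_sets[OF _ refl, of "\<nu> y" borel])
  show int: "integrable (\<nu> y) (\<lambda>z. indicator (ball 0 r) z * norm z)"
    by (rule integrableI_nonneg[OF meas]) (use le in \<open>auto intro: le_less_trans\<close>)
  have "ennreal (\<integral>z. indicator (ball 0 r) z * norm z \<partial>\<nu> y) \<le> ennreal (C\<^sub>2 * r powr (1 - \<sigma>))"
    using le nn_integral_eq_integral[OF int] by simp
  then show "(\<integral>z. indicator (ball 0 r) z * norm z \<partial>\<nu> y) \<le> C\<^sub>2 * r powr (1 - \<sigma>)"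
    using C_nonneg by (simp add: ennreal_le_iff)
qed

lemma set_integrable_increment_near:
  assumes "continuous_on (closure \<Omega>) f" "y \<in> closure \<Omega>" "0 < r" "r < 1" "0 \<le> K"
    and "\<And>z. norm z < r \<Longrightarrow> y + z \<in> closure \<Omega> \<Longrightarrow> \<bar>f (y + z) - f y\<bar> \<le> K * norm z"
  shows "set_integrable (\<nu> y) (nonlocal_set \<Omega> (ball 0 r) y) (\<lambda>z. f (y + z) - f y)"
  unfolding set_integrable_def
proof (rule Bochner_Integration.integrable_bound)
  show "integrable (\<nu> y) (\<lambda>z. K * (indicator (ball 0 r) z * norm z))"
    by (intro integrable_mult_right integral_norm_near_zero assms)
  show "AE z in \<nu> y. norm (indicator (nonlocal_set \<Omega> (ball 0 r) y) z *\<^sub>R (f (y + z) - f y))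
          \<le> norm (K * (indicator (ball 0 r) z * norm z))"
    using assms(5,6) by (intro AE_I2) (auto simp: nonlocal_set_def split: split_indicator)
qed (intro increment_measurable assms, simp)

lemma set_integrable_increment_far:
  fixes f :: "'a \<Rightarrow> real"
  assumes f: "continuous_on (closure \<Omega>) f" and y: "y \<in> closure \<Omega>"
    and D: "D \<in> sets borel" "0 < \<delta>" "D \<subseteq> - ball 0 \<delta>"
  shows "set_integrable (\<nu> y) (nonlocal_set \<Omega> D y) (\<lambda>z. f (y + z) - f y)"
proof -
  obtain B where B: "\<And>x. x \<in> closure \<Omega> \<Longrightarrow> \<bar>f x\<bar> \<le> B"
    using compact_imp_bounded[OF compact_continuous_image[OF f compact_closure_\<Omega>]]
    by (auto simp: bounded_iff)
  have "emeasure (\<nu> y) (- ball 0 \<delta>) < \<infinity>"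
    using tail[OF y D(2)] by (auto intro: le_less_trans)
  moreover have "- ball 0 \<delta> \<in> sets (\<nu> y)" using sets_\<nu>[OF y] by auto
  moreover have "\<bar>f (y + z) - f y\<bar> \<le> 2 * B" if "y + z \<in> closure \<Omega>" for z
    using B[OF that] B[OF y] by linarith
  ultimately show ?thesis
    unfolding set_integrable_def using D increment_measurable[OF f y D(1)] order_trans[OF abs_ge_zero B[OF y]]
    by (intro integrableI_bounded_set[where A = "- ball 0 \<delta>" and B = "2 * B"] AE_I2)
       (auto simp: nonlocal_set_def split: split_indicator)
qed

text \<open>The supersolution has only a one-sided increment bound, which does not imply
  integrability; hence the separate hypothesis. On an annulus it follows from the finite mass away
  from the origin.\<close>

lemma nonlocal_near_lower_bound:
  assumes "y \<in> closure \<Omega>" "0 < r" "r < 1" "0 \<le> K" "D \<subseteq> ball 0 r"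
    and int: "set_integrable (\<nu> y) (nonlocal_set \<Omega> D y) (\<lambda>z. f (y + z) - f y)"
    and low: "\<And>z. norm z < r \<Longrightarrow> y + z \<in> closure \<Omega> \<Longrightarrow> - (K * norm z) \<le> f (y + z) - f y"
  shows "- (K * (C\<^sub>2 * r powr (1 - \<sigma>))) \<le> nonlocal \<Omega> \<nu> D f y"
proof -
  have "- (K * (C\<^sub>2 * r powr (1 - \<sigma>))) \<le> - (K * (\<integral>z. indicator (ball 0 r) z * norm z \<partial>\<nu> y))"
    using integral_norm_near_zero(2)[OF assms(1-3)] assms(4) by (simp add: mult_left_mono)
  also have "\<dots> = (\<integral>z. - K * (indicator (ball 0 r) z * norm z) \<partial>\<nu> y)" by simp
  also have "\<dots> \<le> nonlocal \<Omega> \<nu> D f y"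
    unfolding nonlocal_def set_lebesgue_integral_def
  proof (rule integral_mono)
    fix z
    show "- K * (indicator (ball 0 r) z * norm z) \<le> indicator (nonlocal_set \<Omega> D y) z *\<^sub>R (f (y + z) - f y)"
    proof (cases "z \<in> nonlocal_set \<Omega> D y")
      case True
      then have "z \<in> ball 0 r" "y + z \<in> closure \<Omega>" using assms(5) by (auto simp: nonlocal_set_def)
      then show ?thesis using True low[of z] by simp
    next
      case False
      then show ?thesis using assms(4) by (simp add: zero_le_mult_iff)
    qed
  qed (use int in \<open>auto simp: set_integrable_def intro!: integrable_mult_right integral_norm_near_zero assms\<close>)
  finally show ?thesis .
qed

lemma nonlocal_uminus: "nonlocal \<Omega> \<nu> D (\<lambda>x. - f x) y = - nonlocal \<Omega> \<nu> D f y"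
  unfolding nonlocal_def set_lebesgue_integral_def
  by (subst integral_minus[symmetric], rule Bochner_Integration.integral_cong) (auto simp: algebra_simps)

lemma nonlocal_near_upper_bound:
  assumes "y \<in> closure \<Omega>" "0 < r" "r < 1" "0 \<le> K" "D \<subseteq> ball 0 r"
    and int: "set_integrable (\<nu> y) (nonlocal_set \<Omega> D y) (\<lambda>z. f (y + z) - f y)"
    and up: "\<And>z. norm z < r \<Longrightarrow> y + z \<in> closure \<Omega> \<Longrightarrow> f (y + z) - f y \<le> K * norm z"
  shows "nonlocal \<Omega> \<nu> D f y \<le> K * (C\<^sub>2 * r powr (1 - \<sigma>))"
proof -
  have "set_integrable (\<nu> y) (nonlocal_set \<Omega> D y) (\<lambda>z. - 1 * (f (y + z) - f y))"
    using int by (intro set_integrable_mult_right) auto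
  then have "set_integrable (\<nu> y) (nonlocal_set \<Omega> D y) (\<lambda>z. - f (y + z) - - f y)" by simp
  from nonlocal_near_lower_bound[OF assms(1-5) this] up
  show ?thesis unfolding nonlocal_uminus by fastforce
qed

text \<open>Jumps between \<delta> and \<open>r\<close> are absorbed by Lipschitz-type bounds
  uniform in \<delta>; those beyond \<open>r\<close> are kept exactly for the later limit.\<close>

lemma nonlocal_split:
  assumes "continuous_on (closure \<Omega>) f" "y \<in> closure \<Omega>" "0 < \<delta>" "\<delta> \<le> r"
  shows "nonlocal \<Omega> \<nu> (- ball 0 \<delta>) f y
       = nonlocal \<Omega> \<nu> (ball 0 r - ball 0 \<delta>) f y + nonlocal \<Omega> \<nu> (- ball 0 r) f y"
proof -
  have "nonlocal_set \<Omega> (- ball 0 \<delta>) y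
      = nonlocal_set \<Omega> (ball 0 r - ball 0 \<delta>) y \<union> nonlocal_set \<Omega> (- ball 0 r) y"
    using assms by (auto simp: nonlocal_set_def)
  then show ?thesis
    unfolding nonlocal_def using assms
    by (simp only:) (intro set_integral_Un set_integrable_increment_far[of _ _ _ \<delta>]; auto simp: nonlocal_set_def)
qed

lemma nonlocal_far_bound:
  assumes f: "continuous_on (closure \<Omega>) f" and y: "y \<in> closure \<Omega>" and r: "0 < r"
    and B: "\<And>x. x \<in> closure \<Omega> \<Longrightarrow> \<bar>f x\<bar> \<le> B"
  shows "\<bar>nonlocal \<Omega> \<nu> (- ball 0 r) f y\<bar> \<le> 2 * B * (C\<^sub>1 * r powr - \<sigma>)"
proof -
  have B0: "0 \<le> B" using B[OF y] by linarith
  have inc: "\<bar>f (y + z) - f y\<bar> \<le> 2 * B" if "y + z \<in> closure \<Omega>" for z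
    using B[OF that] B[OF y] by linarith
  have s: "- ball 0 r \<in> sets (\<nu> y)" using sets_\<nu>[OF y] by auto
  have fin: "emeasure (\<nu> y) (- ball 0 r) < \<infinity>"
    using tail[OF y r] by (auto intro: le_less_trans)
  have m: "measure (\<nu> y) (- ball 0 r) \<le> C\<^sub>1 * r powr - \<sigma>"
    unfolding measure_def using tail[OF y r] C_nonneg by (intro enn2real_leI) auto
  have "\<bar>nonlocal \<Omega> \<nu> (- ball 0 r) f y\<bar>
      \<le> (\<integral>z. norm (indicator (nonlocal_set \<Omega> (- ball 0 r) y) z *\<^sub>R (f (y + z) - f y)) \<partial>\<nu> y)"
    unfolding nonlocal_def set_lebesgue_integral_def
    using integral_norm_bound[of "\<nu> y" "\<lambda>z. indicator (nonlocal_set \<Omega> (- ball 0 r) y) z *\<^sub>R (f (y + z) - f y)"]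
    by simp
  also have "\<dots> \<le> (\<integral>z. 2 * B * indicator (- ball 0 r) z \<partial>\<nu> y)"
  proof (rule integral_mono)
    show "integrable (\<nu> y) (\<lambda>z. norm (indicator (nonlocal_set \<Omega> (- ball 0 r) y) z *\<^sub>R (f (y + z) - f y)))"
      using set_integrable_increment_far[OF f y _ r, of "- ball 0 r"]
      unfolding set_integrable_def by (intro integrable_norm) auto
    show "integrable (\<nu> y) (\<lambda>z. 2 * B * indicator (- ball 0 r) z)"
      using s fin by (intro integrable_mult_right integrable_real_indicator)
  qed (use inc B0 in \<open>auto simp: nonlocal_set_def split: split_indicator\<close>)
  also have "\<dots> = 2 * B * measure (\<nu> y) (- ball 0 r)"
    using s by simp
  also have "\<dots> \<le> 2 * B * (C\<^sub>1 * r powr - \<sigma>)"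
    using m B0 by (intro mult_left_mono) auto
  finally show ?thesis .
qed

lemma nonlocal_far_diff:
  assumes "continuous_on (closure \<Omega>) f" "continuous_on (closure \<Omega>) g" "y \<in> closure \<Omega>" "0 < r"
  shows "nonlocal \<Omega> \<nu> (- ball 0 r) (\<lambda>x. f x - g x) y
       = nonlocal \<Omega> \<nu> (- ball 0 r) f y - nonlocal \<Omega> \<nu> (- ball 0 r) g y"
proof -
  have "(\<lambda>z. f (y + z) - g (y + z) - (f y - g y)) = (\<lambda>z. (f (y + z) - f y) - (g (y + z) - g y))"
    by auto
  then show ?thesis
    unfolding nonlocal_def using assms
    by (simp only:) (intro set_integral_diff(2) set_integrable_increment_far[of _ _ _ r]; auto)
qed

text \<open>(M0-2) gives continuity only for C1 functions; the continuous ones follow by uniform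
  approximation with polynomials, because the mass away from the origin is uniformly bounded.\<close>

lemma continuous_on_nonlocal_far:
  assumes M: "M0_2 \<Omega> \<nu>" and f: "continuous_on (closure \<Omega>) f" and r: "0 < r"
  shows "continuous_on (closure \<Omega>) (nonlocal \<Omega> \<nu> (- ball 0 r) f)"
proof (cases "\<Omega> = {}")
  case False
  then obtain x where x: "x \<in> closure \<Omega>" using closure_subset by blast
  \<comment> \<open>A ball containing the whole closure turns the local continuity of (M0-2) into
    continuity on all of it.\<close>
  obtain R where R: "R > 0" "closure \<Omega> \<subseteq> ball x R"
    using bounded_subset_ballD[OF bounded_closure[OF bounded_\<Omega>]] by blast
  have "\<exists>g. real_polynomial_function g \<and> (\<forall>x\<in>closure \<Omega>. \<bar>f x - g x\<bar> < inverse (real (Suc n)))" for n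
    using Stone_Weierstrass_real_polynomial_function[OF compact_closure_\<Omega> f, of "inverse (real (Suc n))"]
    by (metis inverse_positive_iff_positive of_nat_0_less_iff zero_less_Suc)
  then obtain g where g: "\<And>n. real_polynomial_function (g n)"
    and fg: "\<And>n x. x \<in> closure \<Omega> \<Longrightarrow> \<bar>f x - g n x\<bar> < inverse (real (Suc n))"
    by metis
  have gc: "continuous_on S (g n)" for S n
    using g by (auto intro: continuous_on_polymonial_function simp: real_polynomial_function_eq)
  have cont: "continuous_on (closure \<Omega>) (nonlocal \<Omega> \<nu> (- ball 0 r) (g n))" for n
  proof -
    obtain Dg where "C1_on UNIV (g n) Dg" using real_polynomial_function_C1[OF g] by blast
    then have "C1_on (ball x R \<inter> closure \<Omega>) (g n) Dg"
      unfolding C1_on_def by (auto intro: has_derivative_at_withinI continuous_on_subset)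
    moreover have "g n \<in> borel_measurable (restrict_space borel (closure \<Omega>))"
      by (rule borel_measurable_continuous_on_restrict[OF gc])
    moreover have "bounded (g n ` closure \<Omega>)"
      by (rule compact_imp_bounded[OF compact_continuous_image[OF gc compact_closure_\<Omega>]])
    ultimately have "\<forall>D\<in>sets borel. continuous_on (ball x R \<inter> closure \<Omega>) (nonlocal \<Omega> \<nu> D (g n))"
      using M x R(1) unfolding M0_2_def by blast
    moreover have "ball x R \<inter> closure \<Omega> = closure \<Omega>" using R by blast
    ultimately show ?thesis by auto
  qed
  \<comment> \<open>The constant of \<open>nonlocal_far_bound\<close>, to be applied to
    \<open>g n - f\<close>; it does not depend on the base point.\<close>
  define c where "c = 2 * (C\<^sub>1 * r powr - \<sigma>)"
  have c0: "0 \<le> c" using C_nonneg by (simp add: c_def)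
  have bound: "\<bar>nonlocal \<Omega> \<nu> (- ball 0 r) (g n) y - nonlocal \<Omega> \<nu> (- ball 0 r) f y\<bar> \<le> c * inverse (real (Suc n))"
    if y: "y \<in> closure \<Omega>" for n y
  proof -
    have "\<bar>nonlocal \<Omega> \<nu> (- ball 0 r) (\<lambda>x. g n x - f x) y\<bar> \<le> 2 * inverse (real (Suc n)) * (C\<^sub>1 * r powr - \<sigma>)"
      by (rule nonlocal_far_bound)
         (use f gc y r fg in \<open>auto intro!: continuous_intros less_imp_le simp: abs_minus_commute\<close>)
    then show ?thesis
      unfolding nonlocal_far_diff[OF gc f y r] c_def by (simp add: mult_ac)
  qed
  have "uniform_limit (closure \<Omega>) (\<lambda>n. nonlocal \<Omega> \<nu> (- ball 0 r) (g n)) (nonlocal \<Omega> \<nu> (- ball 0 r) f) sequentially"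
  proof (rule uniform_limitI)
    fix e :: real assume e: "e > 0"
    have "(\<lambda>n. c * inverse (real (Suc n))) \<longlonglongrightarrow> c * 0"
      by (intro tendsto_intros LIMSEQ_inverse_real_of_nat)
    then have "\<forall>\<^sub>F n in sequentially. c * inverse (real (Suc n)) < e"
      using e by (intro order_tendstoD(2)[of _ "c * 0"]) auto
    then show "\<forall>\<^sub>F n in sequentially. \<forall>y\<in>closure \<Omega>.
        dist (nonlocal \<Omega> \<nu> (- ball 0 r) (g n) y) (nonlocal \<Omega> \<nu> (- ball 0 r) f y) < e"
      by eventually_elim (use bound in \<open>auto simp: dist_real_def intro: le_less_trans\<close>)
  qed
  then show ?thesis
    by (rule uniform_limit_theorem[rotated]) (use cont in auto)
qed simp

section \<open>Viscosity inequalities at the doubled maximum and their limit\<close>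

text \<open>Subtract the two viscosity inequalities, tested with the penalisation with one variable
  frozen. The test functions only act on jumps below \<delta> and disappear as \<delta> tends to 0.
  Jumps between \<delta> and \<open>r\<close> cost \<open>L\<close> for \<open>w\<close> and
  \<open>L + 3\<close> for \<open>u\<close>.\<close>

lemma doubling_inequality:
  fixes w u :: "'a \<Rightarrow> real" and H :: "'a \<Rightarrow> 'a \<Rightarrow> real"
  assumes w: "L-lipschitz_on (closure \<Omega>) w" and u: "continuous_on (closure \<Omega>) u"
    and sub: "visc_subsolution \<Omega> \<nu> H c \<Omega> w" and super: "visc_supersolution \<Omega> \<nu> H c (closure \<Omega>) u"
    and x: "x \<in> \<Omega>" and y: "y \<in> closure \<Omega>"
    and max: "\<And>x' y'. x' \<in> closure \<Omega> \<Longrightarrow> y' \<in> closure \<Omega> \<Longrightarrow>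
                w x' - u y' - A * (norm (x' - y' - b))\<^sup>2 - (norm (y' - a))\<^sup>2
              \<le> w x - u y - A * (norm (x - y - b))\<^sup>2 - (norm (y - a))\<^sup>2"
    and low: "\<And>z. norm z < r \<Longrightarrow> y + z \<in> closure \<Omega> \<Longrightarrow> - (L + 3) * norm z \<le> u (y + z) - u y"
    and r: "0 < r" "r < 1"
    and p: "p = (2 * A) *\<^sub>R (x - y - b)" and q: "q = 2 *\<^sub>R (y - a)"
  shows "H x p - H y (p - q)
       \<le> nonlocal \<Omega> \<nu> (- ball 0 r) w x - nonlocal \<Omega> \<nu> (- ball 0 r) u y
         + (2 * L + 3) * (C\<^sub>2 * r powr (1 - \<sigma>))"
proof -
  have L0: "0 \<le> L" using w by (rule lipschitz_on_nonneg)
  have wc: "continuous_on (closure \<Omega>) w" using w by (rule lipschitz_on_continuous_on)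
  have xc: "x \<in> closure \<Omega>" using x closure_subset by blast
  \<comment> \<open>The summand with weight 0 brings \<phi> into the shape of
    \<open>C1_on_sum_square_norm\<close>.\<close>
  define \<phi> where "\<phi> x' = A * (norm (x' - (y + b)))\<^sup>2 + 0 * (norm (x' - 0))\<^sup>2" for x' :: 'a
  define \<psi> where "\<psi> y' = - A * (norm (y' - (x - b)))\<^sup>2 + - 1 * (norm (y' - a))\<^sup>2" for y' :: 'a
  define D\<phi> where "D\<phi> x' = (2 * A) *\<^sub>R (x' - (y + b)) + (2 * 0) *\<^sub>R (x' - 0)" for x' :: 'a
  define D\<psi> where "D\<psi> y' = (2 * - A) *\<^sub>R (y' - (x - b)) + (2 * - 1) *\<^sub>R (y' - a)" for y' :: 'a
  have C1\<phi>: "C1_on (closure \<Omega>) \<phi> D\<phi>" unfolding \<phi>_def D\<phi>_def by (rule C1_on_sum_square_norm)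
  have C1\<psi>: "C1_on (closure \<Omega>) \<psi> D\<psi>" unfolding \<psi>_def D\<psi>_def by (rule C1_on_sum_square_norm)
  have D: "D\<phi> x = p" "D\<psi> y = p - q"
    by (simp_all add: D\<phi>_def D\<psi>_def p q algebra_simps)
  have \<phi>c: "continuous_on (closure \<Omega>) \<phi>" and \<psi>c: "continuous_on (closure \<Omega>) \<psi>"
    unfolding \<phi>_def \<psi>_def by (intro continuous_intros)+
  have max_w: "\<forall>x'\<in>closure \<Omega>. w x' - \<phi> x' \<le> w x - \<phi> x"
    using max[OF _ y] by (simp add: \<phi>_def diff_diff_eq)
  have min_u: "\<forall>y'\<in>closure \<Omega>. u y - \<psi> y \<le> u y' - \<psi> y'"
  proof
    fix y' assume "y' \<in> closure \<Omega>"
    moreover have "norm (y' - (x - b)) = norm (x - y' - b)" for y'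
      by (subst norm_minus_commute) (simp add: algebra_simps)
    ultimately show "u y - \<psi> y \<le> u y' - \<psi> y'"
      using max[OF xc, of y'] by (simp add: \<psi>_def)
  qed
  \<comment> \<open>These constants grow with \<open>A\<close>, so \<delta> has to tend to 0 while
    the doubled point stays fixed.\<close>
  define K\<^sub>1 K\<^sub>2 where "K\<^sub>1 = \<bar>A\<bar> * (2 * norm (x - (y + b)) + 1) + \<bar>0\<bar> * (2 * norm (x - 0) + 1)"
    and "K\<^sub>2 = \<bar>- A\<bar> * (2 * norm (y - (x - b)) + 1) + \<bar>- 1\<bar> * (2 * norm (y - a) + 1)"
  have K0: "0 \<le> K\<^sub>1" "0 \<le> K\<^sub>2" by (auto simp: K\<^sub>1_def K\<^sub>2_def)
  have inc\<phi>: "\<bar>\<phi> (x + z) - \<phi> x\<bar> \<le> K\<^sub>1 * norm z" if "norm z \<le> 1" for z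
    unfolding \<phi>_def K\<^sub>1_def by (rule sum_square_norm_increment_le[OF that])
  have inc\<psi>: "\<bar>\<psi> (y + z) - \<psi> y\<bar> \<le> K\<^sub>2 * norm z" if "norm z \<le> 1" for z
    unfolding \<psi>_def K\<^sub>2_def by (rule sum_square_norm_increment_le[OF that])
  show ?thesis
  proof (rule le_if_le_add_powr[of r "1 - \<sigma>"])
    fix \<delta> :: real assume \<delta>: "0 < \<delta>" "\<delta> < r"
    have "nonlocal \<Omega> \<nu> (ball 0 \<delta>) \<phi> x \<le> K\<^sub>1 * (C\<^sub>2 * \<delta> powr (1 - \<sigma>))"
    proof (rule nonlocal_near_upper_bound)
      show "set_integrable (\<nu> x) (nonlocal_set \<Omega> (ball 0 \<delta>) x) (\<lambda>z. \<phi> (x + z) - \<phi> x)"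
        by (rule set_integrable_increment_near[OF \<phi>c xc \<delta>(1) _ K0(1)]) (use \<delta> r inc\<phi> in auto)
      show "\<phi> (x + z) - \<phi> x \<le> K\<^sub>1 * norm z" if "norm z < \<delta>" for z
        using inc\<phi>[of z] that \<delta> r by linarith
    qed (use \<delta> r xc K0 in auto)
    moreover have "- (K\<^sub>2 * (C\<^sub>2 * \<delta> powr (1 - \<sigma>))) \<le> nonlocal \<Omega> \<nu> (ball 0 \<delta>) \<psi> y"
    proof (rule nonlocal_near_lower_bound)
      show "set_integrable (\<nu> y) (nonlocal_set \<Omega> (ball 0 \<delta>) y) (\<lambda>z. \<psi> (y + z) - \<psi> y)"
        by (rule set_integrable_increment_near[OF \<psi>c y \<delta>(1) _ K0(2)]) (use \<delta> r inc\<psi> in auto)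
      show "- (K\<^sub>2 * norm z) \<le> \<psi> (y + z) - \<psi> y" if "norm z < \<delta>" for z
        using inc\<psi>[of z] that \<delta> r by linarith
    qed (use \<delta> r y K0 in auto)
    moreover have "nonlocal \<Omega> \<nu> (ball 0 r - ball 0 \<delta>) w x \<le> L * (C\<^sub>2 * r powr (1 - \<sigma>))"
    proof (rule nonlocal_near_upper_bound[OF xc r L0])
      show "set_integrable (\<nu> x) (nonlocal_set \<Omega> (ball 0 r - ball 0 \<delta>) x) (\<lambda>z. w (x + z) - w x)"
        using \<delta> by (intro set_integrable_increment_far[OF wc xc]) auto
      show "w (x + z) - w x \<le> L * norm z" if "x + z \<in> closure \<Omega>" for z
        using lipschitz_onD[OF w that xc] by (auto simp: dist_norm)
    qed auto
    moreover have "- ((L + 3) * (C\<^sub>2 * r powr (1 - \<sigma>))) \<le> nonlocal \<Omega> \<nu> (ball 0 r - ball 0 \<delta>) u y"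
    proof (rule nonlocal_near_lower_bound[OF y r])
      show "set_integrable (\<nu> y) (nonlocal_set \<Omega> (ball 0 r - ball 0 \<delta>) y) (\<lambda>z. u (y + z) - u y)"
        using \<delta> by (intro set_integrable_increment_far[OF u y]) auto
      show "- ((L + 3) * norm z) \<le> u (y + z) - u y" if "norm z < r" "y + z \<in> closure \<Omega>" for z
        using low[OF that] by (simp only: mult_minus_left)
    qed (use L0 in auto)
    moreover have "- nonlocal \<Omega> \<nu> (ball 0 \<delta>) \<phi> x - nonlocal \<Omega> \<nu> (- ball 0 \<delta>) w x + H x p \<le> c"
      using sub C1\<phi> \<delta>(1) x max_w D(1) unfolding visc_subsolution_def by metis
    moreover have "- nonlocal \<Omega> \<nu> (ball 0 \<delta>) \<psi> y - nonlocal \<Omega> \<nu> (- ball 0 \<delta>) u y + H y (p - q) \<ge> c"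
      using super C1\<psi> \<delta>(1) y min_u D(2) unfolding visc_supersolution_def by metis
    ultimately show "H x p - H y (p - q)
       \<le> nonlocal \<Omega> \<nu> (- ball 0 r) w x - nonlocal \<Omega> \<nu> (- ball 0 r) u y
         + (2 * L + 3) * (C\<^sub>2 * r powr (1 - \<sigma>)) + (K\<^sub>1 + K\<^sub>2) * C\<^sub>2 * \<delta> powr (1 - \<sigma>)"
      unfolding nonlocal_split[OF wc xc \<delta>(1) less_imp_le[OF \<delta>(2)]]
        nonlocal_split[OF u y \<delta>(1) less_imp_le[OF \<delta>(2)]]
      by (simp add: algebra_simps)
  qed (use r \<sigma> in auto)
qed

text \<open>With \<open>r\<close> fixed, let the doubled points tend to \<open>a\<close>. The
  large-jump terms converge by continuity. The momenta stay bounded by the Lipschitz constant of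
  \<open>w\<close>, so uniform continuity of \<open>H\<close> on a compact set removes the
  Hamiltonians. The result holds even at a boundary point \<open>a\<close>, where no subsolution
  inequality for \<open>w\<close> is given.\<close>

lemma nonlocal_far_at_maximum:
  fixes w u :: "'a \<Rightarrow> real" and H :: "'a \<Rightarrow> 'a \<Rightarrow> real"
  assumes \<Omega>: "open \<Omega>" "C1_boundary \<Omega>" and M: "M0_2 \<Omega> \<nu>"
    and H: "continuous_on (closure \<Omega> \<times> UNIV) (\<lambda>(x, p). H x p)"
    and w: "L-lipschitz_on (closure \<Omega>) w" and u: "continuous_on (closure \<Omega>) u"
    and sub: "visc_subsolution \<Omega> \<nu> H c \<Omega> w" and super: "visc_supersolution \<Omega> \<nu> H c (closure \<Omega>) u"
    and a: "a \<in> closure \<Omega>" and max: "\<And>x. x \<in> closure \<Omega> \<Longrightarrow> w x - u x \<le> w a - u a"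
  obtains \<rho> where "0 < \<rho>"
    and "\<And>r. 0 < r \<Longrightarrow> r < \<rho> \<Longrightarrow>
           nonlocal \<Omega> \<nu> (- ball 0 r) u a - nonlocal \<Omega> \<nu> (- ball 0 r) w a
           \<le> (2 * L + 3) * (C\<^sub>2 * r powr (1 - \<sigma>))"
proof -
  obtain \<rho> where \<rho>: "0 < \<rho>"
    and dbl: "\<forall>\<theta>>0. \<exists>x\<in>\<Omega>. \<exists>y\<in>closure \<Omega>. \<exists>A b. dist x a < \<theta> \<and> dist y a < \<theta> \<and>
           (\<forall>x'\<in>closure \<Omega>. \<forall>y'\<in>closure \<Omega>.
              w x' - u y' - A * (norm (x' - y' - b))\<^sup>2 - (norm (y' - a))\<^sup>2
            \<le> w x - u y - A * (norm (x - y - b))\<^sup>2 - (norm (y - a))\<^sup>2) \<and>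
           (\<forall>z. norm z < \<rho> \<longrightarrow> y + z \<in> closure \<Omega> \<longrightarrow> - (L + 3) * norm z \<le> u (y + z) - u y)"
    by (rule doubling_of_variables[OF \<Omega>(1) bounded_\<Omega> \<Omega>(2) w u a max])
  have wc: "continuous_on (closure \<Omega>) w" using w by (rule lipschitz_on_continuous_on)
  have "nonlocal \<Omega> \<nu> (- ball 0 r) u a - nonlocal \<Omega> \<nu> (- ball 0 r) w a
           \<le> (2 * L + 3) * (C\<^sub>2 * r powr (1 - \<sigma>))" (is "?G u a - ?G w a \<le> ?C")
    if r: "0 < r" "r < min \<rho> 1" for r
  proof (rule field_le_epsilon)
    fix e :: real assume e: "0 < e"
    have G: "\<exists>d>0. \<forall>x\<in>closure \<Omega>. dist x a < d \<longrightarrow> dist (?G f x) (?G f a) < e / 3"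
      if "continuous_on (closure \<Omega>) f" for f
      using continuous_on_nonlocal_far[OF M that r(1), unfolded continuous_on_iff, rule_format, OF a, of "e / 3"] e
      by auto
    obtain d\<^sub>1 where d1: "0 < d\<^sub>1"
      and Gw: "\<And>x. x \<in> closure \<Omega> \<Longrightarrow> dist x a < d\<^sub>1 \<Longrightarrow> dist (?G w x) (?G w a) < e / 3"
      using G[OF wc] by blast
    obtain d\<^sub>2 where d2: "0 < d\<^sub>2"
      and Gu: "\<And>x. x \<in> closure \<Omega> \<Longrightarrow> dist x a < d\<^sub>2 \<Longrightarrow> dist (?G u x) (?G u a) < e / 3"
      using G[OF u] by blast
    \<comment> \<open>The radius accommodates \<open>norm p \<le> L\<close> and
      \<open>norm q < 2 * \<theta> \<le> 2\<close>.\<close>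
    have "compact (closure \<Omega> \<times> cball (0::'a) (L + 2))"
      by (intro compact_Times compact_closure_\<Omega> compact_cball)
    moreover have "continuous_on (closure \<Omega> \<times> cball 0 (L + 2)) (\<lambda>(x, p). H x p)"
      using H by (rule continuous_on_subset) auto
    ultimately have "uniformly_continuous_on (closure \<Omega> \<times> cball 0 (L + 2)) (\<lambda>(x, p). H x p)"
      by (intro compact_uniformly_continuous)
    from uniformly_continuous_onE[OF this, of "e / 3"] e obtain d\<^sub>3 where d3: "0 < d\<^sub>3"
      and unif: "\<And>P Q. P \<in> closure \<Omega> \<times> cball 0 (L + 2) \<Longrightarrow> Q \<in> closure \<Omega> \<times> cball 0 (L + 2) \<Longrightarrow>
                  dist Q P < d\<^sub>3 \<Longrightarrow> dist (case Q of (x, p) \<Rightarrow> H x p) (case P of (x, p) \<Rightarrow> H x p) < e / 3"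
      by (metis (no_types, lifting) divide_pos_pos zero_less_numeral)
    \<comment> \<open>The two Hamiltonian arguments differ by less than \<open>4 * \<theta>\<close>:
      half of it comes from \<open>x\<close> and \<open>y\<close>, half from
      \<open>q\<close>.\<close>
    define \<theta> where "\<theta> = min (min d\<^sub>1 d\<^sub>2) (min (d\<^sub>3 / 4) 1)"
    have \<theta>: "0 < \<theta>" "\<theta> \<le> d\<^sub>1" "\<theta> \<le> d\<^sub>2" "\<theta> \<le> d\<^sub>3 / 4" "\<theta> \<le> 1"
      using d1 d2 d3 by (auto simp: \<theta>_def)
    obtain x y A b where x: "x \<in> \<Omega>" and y: "y \<in> closure \<Omega>"
      and xa: "dist x a < \<theta>" and ya: "dist y a < \<theta>"
      and m: "\<And>x' y'. x' \<in> closure \<Omega> \<Longrightarrow> y' \<in> closure \<Omega> \<Longrightarrow>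
              w x' - u y' - A * (norm (x' - y' - b))\<^sup>2 - (norm (y' - a))\<^sup>2
            \<le> w x - u y - A * (norm (x - y - b))\<^sup>2 - (norm (y - a))\<^sup>2"
      and low: "\<And>z. norm z < \<rho> \<Longrightarrow> y + z \<in> closure \<Omega> \<Longrightarrow> - (L + 3) * norm z \<le> u (y + z) - u y"
      using dbl[rule_format, OF \<theta>(1)] by blast
    have xc: "x \<in> closure \<Omega>" using x closure_subset by blast
    define p q where "p = (2 * A) *\<^sub>R (x - y - b)" and "q = 2 *\<^sub>R (y - a)"
    \<comment> \<open>This vector is \<open>p\<close>, written as the gradient at \<open>x\<close>
      of the test function touching \<open>w\<close>.\<close>
    have "norm ((2 * A) *\<^sub>R (x - (y + b)) + (2 * 0) *\<^sub>R (x - 0)) \<le> L"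
      by (rule lipschitz_touching_gradient_le[OF w \<Omega>(1) x C1_on_sum_square_norm])
         (use m[OF _ y] in \<open>simp add: diff_diff_eq\<close>)
    then have pL: "norm p \<le> L" by (simp add: p_def diff_diff_eq)
    have q\<theta>: "norm q < 2 * \<theta>" using ya by (simp add: q_def dist_norm)
    have main: "H x p - H y (p - q) \<le> ?G w x - ?G u y + ?C"
      by (rule doubling_inequality[OF w u sub super x y m low]) (use r p_def q_def in auto)
    have "dist (x, p) (y, p - q) \<le> dist x y + norm q"
      unfolding dist_Pair_Pair using sqrt_sum_squares_le_sum[of "dist x y" "dist p (p - q)"]
      by (simp add: dist_norm)
    also have "\<dots> < d\<^sub>3" using dist_triangle2[of x y a] xa ya q\<theta> \<theta>(4) by linarith
    finally have "dist (H x p) (H y (p - q)) < e / 3"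
      using pL q\<theta> \<theta>(5) norm_triangle_ineq4[of p q] unif[of "(y, p - q)" "(x, p)"] xc y by auto
    moreover have "dist (?G w x) (?G w a) < e / 3" using xa \<theta> by (intro Gw[OF xc]) auto
    moreover have "dist (?G u y) (?G u a) < e / 3" using ya \<theta> by (intro Gu[OF y]) auto
    ultimately show "?G u a - ?G w a \<le> ?C + e"
      using main unfolding dist_real_def by linarith
  qed
  then show ?thesis using that[of "min \<rho> 1"] \<rho> by simp
qed

section \<open>Propagation of the maximum along the supports\<close>

text \<open>By (M0-1) these jumps lie outside the support, hence in null open sets; a countable
  basis reduces the union of such sets to a countable one.\<close>

lemma emeasure_outside_closure:
  assumes M: "M0_1 \<Omega> \<nu>" and y: "y \<in> closure \<Omega>"
  shows "emeasure (\<nu> y) {z. y + z \<notin> closure \<Omega>} = 0"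
proof -
  obtain B :: "'a set set" where B: "countable B" "topological_basis B"
    using ex_countable_basis by blast
  define N where "N = {U \<in> B. emeasure (\<nu> y) U = 0}"
  have sub: "{z. y + z \<notin> closure \<Omega>} \<subseteq> \<Union>N"
  proof
    fix z assume "z \<in> {z. y + z \<notin> closure \<Omega>}"
    then have "z \<notin> measure_support (\<nu> y)" using M y unfolding M0_1_def by auto
    then obtain U where U: "open U" "z \<in> U" "emeasure (\<nu> y) U = 0"
      by (auto simp: measure_support_def)
    then obtain V where V: "V \<in> B" "z \<in> V" "V \<subseteq> U"
      using B(2) topological_basisE by blast
    have "emeasure (\<nu> y) V \<le> emeasure (\<nu> y) U"
      using V U sets_\<nu>[OF y] by (intro emeasure_mono) auto
    then show "z \<in> \<Union>N" using V U by (auto simp: N_def)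
  qed
  have "\<Union>N \<in> null_sets (\<nu> y)"
  proof -
    have "N \<subseteq> null_sets (\<nu> y)"
      using topological_basis_open[OF B(2)] sets_\<nu>[OF y] by (auto simp: N_def null_sets_def)
    moreover have "countable N" using B(1) by (auto simp: N_def)
    ultimately show ?thesis using null_sets_UN'[of N "\<lambda>x. x" "\<nu> y"] by auto
  qed
  then have "emeasure (\<nu> y) (\<Union>N) = 0" "\<Union>N \<in> sets (\<nu> y)" by auto
  then show ?thesis using emeasure_mono[OF sub, of "\<nu> y"] by simp
qed

text \<open>The increments of \<open>u - w\<close> from \<open>a\<close> are nonnegative. If one
  were positive at a support point, it would stay bounded below on a neighbourhood of positive mass,
  and the integral over the large jumps could not be
  \<open>O(r powr (1 - \<sigma>))\<close>.\<close>

lemma maximum_propagates_to_support: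
  fixes w u :: "'a \<Rightarrow> real" and H :: "'a \<Rightarrow> 'a \<Rightarrow> real"
  assumes \<Omega>: "open \<Omega>" "C1_boundary \<Omega>" and M: "M0 \<Omega> \<nu>"
    and H: "continuous_on (closure \<Omega> \<times> UNIV) (\<lambda>(x, p). H x p)"
    and w: "L-lipschitz_on (closure \<Omega>) w" and u: "continuous_on (closure \<Omega>) u"
    and sub: "visc_subsolution \<Omega> \<nu> H c \<Omega> w" and super: "visc_supersolution \<Omega> \<nu> H c (closure \<Omega>) u"
    and a: "a \<in> closure \<Omega>" and max: "\<And>x. x \<in> closure \<Omega> \<Longrightarrow> w x - u x \<le> w a - u a"
    and z: "z \<in> measure_support (\<nu> a)"
  shows "w (a + z) - u (a + z) = w a - u a"
proof (rule ccontr)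
  assume neq: "w (a + z) - u (a + z) \<noteq> w a - u a"
  have M1: "M0_1 \<Omega> \<nu>" and M2: "M0_2 \<Omega> \<nu>" using M by (auto simp: M0_def)
  have wc: "continuous_on (closure \<Omega>) w" using w by (rule lipschitz_on_continuous_on)
  define g where "g x = u x - w x" for x
  have gc: "continuous_on (closure \<Omega>) g" unfolding g_def using u wc by (intro continuous_intros)
  have gmin: "g a \<le> g x" if "x \<in> closure \<Omega>" for x using max[OF that] by (simp add: g_def)
  have azc: "a + z \<in> closure \<Omega>" using M1 a z unfolding M0_1_def by blast
  \<comment> \<open>Half of the gap, so that increments near \<open>z\<close> still exceed the other
    half.\<close>
  define \<eta> where "\<eta> = (g (a + z) - g a) / 2"
  have \<eta>: "0 < \<eta>" using gmin[OF azc] neq by (auto simp: \<eta>_def g_def)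
  have "z \<noteq> 0" using neq by auto
  obtain d where d: "0 < d" and gd: "\<And>x. x \<in> closure \<Omega> \<Longrightarrow> dist x (a + z) < d \<Longrightarrow> dist (g x) (g (a + z)) < \<eta>"
    using gc azc \<eta> unfolding continuous_on_iff by blast
  obtain \<rho> where \<rho>: "0 < \<rho>"
    and le: "\<And>r. 0 < r \<Longrightarrow> r < \<rho> \<Longrightarrow>
           nonlocal \<Omega> \<nu> (- ball 0 r) u a - nonlocal \<Omega> \<nu> (- ball 0 r) w a
           \<le> (2 * L + 3) * (C\<^sub>2 * r powr (1 - \<sigma>))"
    using nonlocal_far_at_maximum[OF \<Omega> M2 H w u sub super a max] by blast
  \<comment> \<open>Keeps a ball of radius \<open>r\<^sub>0\<close> around \<open>z\<close> away
    from the origin, so its mass is finite and counted for every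
    \<open>r < r\<^sub>0\<close>.\<close>
  define r\<^sub>0 where "r\<^sub>0 = min \<rho> (norm z / 2)"
  have r0: "0 < r\<^sub>0" "r\<^sub>0 \<le> \<rho>" "2 * r\<^sub>0 \<le> norm z" using \<rho> \<open>z \<noteq> 0\<close> by (auto simp: r\<^sub>0_def)
  define U where "U = ball z (min d r\<^sub>0)"
  have zU: "z \<in> U" using d r0 by (simp add: U_def)
  have U_far: "U \<subseteq> - ball 0 r\<^sub>0"
  proof
    fix y assume "y \<in> U"
    then show "y \<in> - ball 0 r\<^sub>0" using r0(3) norm_triangle_ineq2[of z "z - y"] by (simp add: U_def dist_norm)
  qed
  define V where "V = nonlocal_set \<Omega> U a"
  have Vb: "V \<in> sets borel" unfolding V_def by (rule nonlocal_set_borel) (simp add: U_def)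
  have V_far: "V \<subseteq> - ball 0 r\<^sub>0" using U_far by (auto simp: V_def nonlocal_set_def)
  have s: "sets (\<nu> a) = sets borel" by (rule sets_\<nu>[OF a])
  have fin: "emeasure (\<nu> a) V < \<infinity>"
  proof -
    have "emeasure (\<nu> a) V \<le> emeasure (\<nu> a) (- ball 0 r\<^sub>0)"
      using V_far s by (intro emeasure_mono) auto
    also have "\<dots> < \<infinity>" using tail[OF a r0(1)] by (auto intro: le_less_trans)
    finally show ?thesis .
  qed
  have "emeasure (\<nu> a) U \<noteq> 0" using z zU by (auto simp: measure_support_def U_def)
  \<comment> \<open>Restricting \<open>U\<close> to admissible jumps removes only a null set, so
    \<open>V\<close> inherits positive mass.\<close>
  moreover have "emeasure (\<nu> a) U \<le> emeasure (\<nu> a) V + emeasure (\<nu> a) {z. a + z \<notin> closure \<Omega>}"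
  proof -
    have "open ((\<lambda>z. a + z) -` (- closure \<Omega>))"
      by (intro open_vimage continuous_intros) auto
    then have N: "{z. a + z \<notin> closure \<Omega>} \<in> sets borel" by (simp add: vimage_def)
    have "emeasure (\<nu> a) U \<le> emeasure (\<nu> a) (V \<union> {z. a + z \<notin> closure \<Omega>})"
      using Vb N s by (intro emeasure_mono) (auto simp: V_def nonlocal_set_def)
    also have "\<dots> \<le> emeasure (\<nu> a) V + emeasure (\<nu> a) {z. a + z \<notin> closure \<Omega>}"
      using Vb N s by (intro emeasure_subadditive) auto
    finally show ?thesis .
  qed
  ultimately have "emeasure (\<nu> a) V \<noteq> 0"
    using emeasure_outside_closure[OF M1 a] by auto
  then have mpos: "0 < measure (\<nu> a) V"
    using fin by (simp add: measure_def enn2real_positive_iff zero_less_iff_neq_zero)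
  have "\<eta> * measure (\<nu> a) V \<le> 0"
  proof (rule le_if_le_add_powr[OF r0(1)])
    show "0 < 1 - \<sigma>" using \<sigma> by simp
    fix r assume r: "0 < r" "r < r\<^sub>0"
    have "\<eta> * measure (\<nu> a) V = (\<integral>z. \<eta> * indicator V z \<partial>\<nu> a)"
      using Vb s by simp
    also have "\<dots> \<le> nonlocal \<Omega> \<nu> (- ball 0 r) g a"
      unfolding nonlocal_def set_lebesgue_integral_def
    proof (rule integral_mono)
      show "integrable (\<nu> a) (\<lambda>z. \<eta> * indicator V z)"
        using Vb s fin by (intro integrable_mult_right integrable_real_indicator) auto
      show "integrable (\<nu> a) (\<lambda>z. indicator (nonlocal_set \<Omega> (- ball 0 r) a) z *\<^sub>R (g (a + z) - g a))"
        using set_integrable_increment_far[OF gc a _ r(1), of "- ball 0 r"]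
        by (simp add: set_integrable_def)
      fix y
      show "\<eta> * indicator V y \<le> indicator (nonlocal_set \<Omega> (- ball 0 r) a) y *\<^sub>R (g (a + y) - g a)"
      proof (cases "y \<in> V")
        case True
        then have y: "a + y \<in> closure \<Omega>" "dist (a + y) (a + z) < d" "y \<notin> ball 0 r"
          using V_far r by (auto simp: V_def nonlocal_set_def U_def dist_commute)
        have "\<eta> \<le> g (a + y) - g a"
          using gd[OF y(1,2)] unfolding dist_real_def \<eta>_def by (simp add: abs_if split: if_splits)
        then show ?thesis using True y by (simp add: nonlocal_set_def)
      next
        case False
        then show ?thesis using gmin[of "a + y"] by (auto simp: nonlocal_set_def split: split_indicator)
      qed
    qed
    also have "\<dots> \<le> (2 * L + 3) * (C\<^sub>2 * r powr (1 - \<sigma>))"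
      unfolding g_def nonlocal_far_diff[OF u wc a r(1)] using r r0 by (intro le) auto
    finally show "\<eta> * measure (\<nu> a) V \<le> 0 + (2 * L + 3) * C\<^sub>2 * r powr (1 - \<sigma>)"
      by (simp add: mult.assoc)
  qed
  then show False using mpos \<eta> by (simp add: mult_le_0_iff)
qed

text \<open>The set of maximum points of \<open>w - u\<close> is closed, and each of its points may
  serve as a new starting point of the propagation. It therefore contains every reachable point and,
  by covering, the whole closure.\<close>

lemma lipschitz_subsolution_diff_constant:
  fixes w u :: "'a \<Rightarrow> real" and H :: "'a \<Rightarrow> 'a \<Rightarrow> real"
  assumes \<Omega>: "open \<Omega>" "C1_boundary \<Omega>" and M: "M0 \<Omega> \<nu>" and cov: "iterative_covering \<Omega> \<nu>"
    and H: "continuous_on (closure \<Omega> \<times> UNIV) (\<lambda>(x, p). H x p)"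
    and w: "L-lipschitz_on (closure \<Omega>) w" and u: "continuous_on (closure \<Omega>) u"
    and sub: "visc_subsolution \<Omega> \<nu> H c \<Omega> w" and super: "visc_supersolution \<Omega> \<nu> H c (closure \<Omega>) u"
  shows "\<exists>k. \<forall>x\<in>closure \<Omega>. w x - u x = k"
proof (cases "\<Omega> = {}")
  case False
  have wc: "continuous_on (closure \<Omega>) w" using w by (rule lipschitz_on_continuous_on)
  have gc: "continuous_on (closure \<Omega>) (\<lambda>x. w x - u x)" using u wc by (intro continuous_intros)
  moreover have "closure \<Omega> \<noteq> {}" using False by simp
  ultimately obtain a where a: "a \<in> closure \<Omega>" and max: "\<And>x. x \<in> closure \<Omega> \<Longrightarrow> w x - u x \<le> w a - u a"
    using continuous_attains_sup[OF compact_closure_\<Omega>] by blast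
  define E where "E = {x \<in> closure \<Omega>. w x - u x = w a - u a}"
  have "closed E"
    unfolding E_def by (rule continuous_closed_preimage_constant[OF gc closed_closure])
  moreover have "reach \<nu> a n \<subseteq> E" for n
  proof (induction n)
    case 0
    then show ?case using a by (simp add: E_def)
  next
    case (Suc n)
    show ?case
    proof
      fix y assume "y \<in> reach \<nu> a (Suc n)"
      then obtain x z where x: "x \<in> reach \<nu> a n" and z: "z \<in> measure_support (\<nu> x)" and y: "y = x + z"
        by auto
      have xE: "x \<in> closure \<Omega>" "w x - u x = w a - u a" using x Suc by (auto simp: E_def)
      have "w (x + z) - u (x + z) = w x - u x"
        by (rule maximum_propagates_to_support[OF \<Omega> M H w u sub super xE(1) _ z])
           (use max xE(2) in metis)
      moreover have "x + z \<in> closure \<Omega>"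
        using M xE(1) z unfolding M0_def M0_1_def by blast
      ultimately show "y \<in> E" using xE y by (simp add: E_def)
    qed
  qed
  ultimately have "closure (\<Union>n. reach \<nu> a n) \<subseteq> E" by (intro closure_minimal) auto
  moreover have "closure (\<Union>n. reach \<nu> a n) = closure \<Omega>"
    using cov a by (simp add: iterative_covering_def)
  ultimately have "closure \<Omega> \<subseteq> E" by simp
  then show ?thesis by (auto simp: E_def)
qed simp

end

section \<open>Verification of the measure bounds and conclusion\<close>

lemma order_below_one_measures_if_M1_M2:
  fixes \<Omega> :: "'a::euclidean_space set"
  assumes "bounded \<Omega>" and sets: "\<And>x. x \<in> closure \<Omega> \<Longrightarrow> sets (\<nu> x) = sets borel"
    and "0 < \<sigma>" "\<sigma> < 1" and M1: "M1 \<Omega> \<nu> \<sigma>" and M2: "M2 \<Omega> \<nu> \<sigma>"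
  obtains C\<^sub>1 C\<^sub>2 where "order_below_one_measures \<Omega> \<nu> \<sigma> C\<^sub>1 C\<^sub>2"
proof -
  obtain C\<^sub>1 where C1: "C\<^sub>1 > 0" "\<And>\<beta> \<delta>. \<beta> \<in> {0..2} \<Longrightarrow> \<delta> > 0 \<Longrightarrow>
        (SUP x\<in>closure \<Omega>. \<integral>\<^sup>+z\<in>- ball 0 \<delta>. ennreal (min 1 (norm z powr \<beta>)) \<partial>\<nu> x)
          \<le> ennreal (C\<^sub>1 * hfun \<beta> \<sigma> \<delta>)"
    using M1 unfolding M1_def by blast
  obtain C\<^sub>2 where C2: "C\<^sub>2 > 0" "\<And>\<beta> \<delta>. \<beta> \<in> {\<sigma><..2} \<Longrightarrow> \<delta> \<in> {0<..<1} \<Longrightarrow>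
        (SUP x\<in>closure \<Omega>. \<integral>\<^sup>+z\<in>ball 0 \<delta>. ennreal (norm z powr \<beta>) \<partial>\<nu> x)
          \<le> ennreal (C\<^sub>2 * \<delta> powr (\<beta> - \<sigma>))"
    using M2 unfolding M2_def by blast
  have "order_below_one_measures \<Omega> \<nu> \<sigma> C\<^sub>1 C\<^sub>2"
  proof
    fix x :: 'a and \<delta> :: real
    assume x: "x \<in> closure \<Omega>" and \<delta>: "0 < \<delta>"
    have "emeasure (\<nu> x) (- ball 0 \<delta>) = (\<integral>\<^sup>+z. indicator (- ball 0 \<delta>) z \<partial>\<nu> x)"
      using sets[OF x] by simp
    \<comment> \<open>\<open>0 powr 0\<close> is 0, but the origin lies inside the removed ball, so
      the integrand is indeed 1.\<close>
    also have "\<dots> = (\<integral>\<^sup>+z\<in>- ball 0 \<delta>. ennreal (min 1 (norm z powr 0)) \<partial>\<nu> x)"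
      using \<delta> by (intro nn_integral_cong) (auto split: split_indicator)
    also have "\<dots> \<le> ennreal (C\<^sub>1 * hfun 0 \<sigma> \<delta>)"
      by (rule order_trans[OF SUP_upper[OF x] C1(2)]) (use \<delta> in auto)
    finally show "emeasure (\<nu> x) (- ball 0 \<delta>) \<le> ennreal (C\<^sub>1 * \<delta> powr - \<sigma>)"
      using \<open>0 < \<sigma>\<close> by (simp add: hfun_def)
    assume "\<delta> < 1"
    have "(\<integral>\<^sup>+z\<in>ball 0 \<delta>. ennreal (norm z) \<partial>\<nu> x) = (\<integral>\<^sup>+z\<in>ball 0 \<delta>. ennreal (norm z powr 1) \<partial>\<nu> x)"
      by simp
    also have "\<dots> \<le> ennreal (C\<^sub>2 * \<delta> powr (1 - \<sigma>))"
      by (rule order_trans[OF SUP_upper[OF x] C2(2)]) (use \<delta> \<open>\<delta> < 1\<close> \<open>\<sigma> < 1\<close> in auto)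
    finally show "(\<integral>\<^sup>+z\<in>ball 0 \<delta>. ennreal (norm z) \<partial>\<nu> x) \<le> ennreal (C\<^sub>2 * \<delta> powr (1 - \<sigma>))" .
  qed (use assms(1,4) sets C1 C2 in auto)
  then show ?thesis ..
qed

theorem proposition5p6:
  fixes \<Omega> :: "'a::euclidean_space set"
    and \<nu> :: "'a \<Rightarrow> 'a measure"
    and H\<^sub>0 :: "'a \<Rightarrow> 'a \<Rightarrow> real"
    and \<sigma> m c :: real
  assumes "bounded_C1_domain \<Omega>"
    and "\<And>x. x \<in> closure \<Omega> \<Longrightarrow> regular_borel_measure (\<nu> x)"
    and "0 < \<sigma>" and "\<sigma> < 1"
    and "M0 \<Omega> \<nu>" and "M1 \<Omega> \<nu> \<sigma>" and "M2 \<Omega> \<nu> \<sigma>" and "M3 \<Omega> \<nu> \<sigma>"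
    and "iterative_covering \<Omega> \<nu>"
    and "continuous_on (closure \<Omega> \<times> UNIV) (\<lambda>(x, p). H\<^sub>0 x p)"
    and "1 < m" and "H2 \<Omega> H\<^sub>0 m"
    and "unique_ergodic_constant \<Omega> \<nu> H\<^sub>0 c"
  shows "\<forall>u v. state_constraint_solution \<Omega> \<nu> H\<^sub>0 c u \<and> state_constraint_solution \<Omega> \<nu> H\<^sub>0 c v \<longrightarrow>
           (\<exists>k. \<forall>x\<in>closure \<Omega>. u x = v x + k)"
proof (intro allI impI)
  fix u v assume uv: "state_constraint_solution \<Omega> \<nu> H\<^sub>0 c u \<and> state_constraint_solution \<Omega> \<nu> H\<^sub>0 c v"
  have \<Omega>: "open \<Omega>" "bounded \<Omega>" "C1_boundary \<Omega>"
    using assms(1) by (auto simp: bounded_C1_domain_def)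
  have "\<And>x. x \<in> closure \<Omega> \<Longrightarrow> sets (\<nu> x) = sets borel"
    using assms(2) by (auto simp: regular_borel_measure_def)
  then obtain C\<^sub>1 C\<^sub>2 where "order_below_one_measures \<Omega> \<nu> \<sigma> C\<^sub>1 C\<^sub>2"
    using order_below_one_measures_if_M1_M2[OF \<Omega>(2) _ assms(3,4,6,7)] by blast
  then interpret order_below_one_measures \<Omega> \<nu> \<sigma> C\<^sub>1 C\<^sub>2 .
  \<comment> \<open>The ergodic constant comes with a Lipschitz solution. Since \<open>u\<close> and
    \<open>v\<close> are only continuous, each is compared with \<open>w\<close> instead of with the
    other.\<close>
  obtain w L where w: "state_constraint_solution \<Omega> \<nu> H\<^sub>0 c w" and L: "L-lipschitz_on (closure \<Omega>) w"
    using assms(13) unfolding unique_ergodic_constant_def has_lipschitz_solution_def by blast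
  have "\<exists>k. \<forall>x\<in>closure \<Omega>. w x - f x = k" if "state_constraint_solution \<Omega> \<nu> H\<^sub>0 c f" for f
    using lipschitz_subsolution_diff_constant[OF \<Omega>(1,3) assms(5,9,10) L] w that
    unfolding state_constraint_solution_def by blast
  from this[of u] this[of v] uv obtain k l where
    "\<And>x. x \<in> closure \<Omega> \<Longrightarrow> w x - u x = k" "\<And>x. x \<in> closure \<Omega> \<Longrightarrow> w x - v x = l" by blast
  then have "\<forall>x\<in>closure \<Omega>. u x = v x + (l - k)" by (auto simp: algebra_simps)
  then show "\<exists>k. \<forall>x\<in>closure \<Omega>. u x = v x + k" ..
qed

end
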